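(* Let $\pi$ be the probability measure on $\mathbf{\Delta}$ with density $\rho(x^1,\dots,x^m,y)=\frac1Z y^{-1/2}$, where $Z$ is a normalizing constant. Then $\pi$ is the unique invariant probability measure for the process $\mathbf{x}_t$; hence it is ergodic.
   Context: Fix a positive integer $m$ and a constant $\bar E>0$. Superscripts are indices, not powers, on the coordinates $x^i$. The state space is the open simplex $$\mathbf{\Delta}=\Big\{(x^{1},\dots,x^{m},y)\in\mathbb{R}^{m+1}_{+}\ :\ y+\sum_{i=1}^{m}x^{i}=\bar E\Big\},$$ (all coordinates strictly positive). Densities are with respect to Lebesgue measure on $\mathbf{\Delta}$ (e.g. in the coordinates $x^1,\dots,x^m$). The process $\mathbf{x}_t=(x^1_t,\dots,x^m_t,y_t)$, $t\ge 0$, is the time-homogeneous Markov jump process on $\mathbf{\Delta}$ defined as follows: $x^i_t$ is the energy of particle $i$ and $y_t$ the energy of a tank. Particle $i$ carries a clock that rings at exponential rate $\sqrt{x^i_t}$ (the rate changes whenever $x^i_t$ changes); the clocks are independent of one another and of history. When the clock of particle $i$ rings at time $t$, the state immediately after is $$x^i_{t^+}=y_t+(1-u^2)x^i_t,\qquad y_{t^+}=u^2x^i_t,\qquad x^j_{t^+}=x^j_t\ \ (j\ne i),$$ where $u$ is a random variable uniform on $(0,1)$, drawn independently at each ring. $P^t(\mathbf{x},\cdot)$ denotes the transition probabilities of $\mathbf{x}_t$, and for a probability measure $\mu$ on $\mathbf{\Delta}$, $(\mu P^t)(A)=\int_{\mathbf{\Delta}}P^t(\mathbf{x},A)\,\mu(d\mathbf{x})$.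 A probability measure $\mu$ is invariant if $\mu P^t=\mu$ for all $t>0$. *)

theory Defs
  imports "HOL-Probability.Probability"
begin

text \<open>
  A state is a pair of the vector of particle energies and the tank energy. The particles are
  indexed by a finite type, so the number of particles is its (arbitrary, positive) cardinality.
\<close>

type_synonym 'm state = "(real ^ 'm) \<times> real"

definition simplex_set :: "real \<Rightarrow> 'm::finite state set" where
  "simplex_set E = {(x, y). (\<forall>i. 0 < x $ i) \<and> 0 < y \<and> y + (\<Sum>i\<in>UNIV. x $ i) = E}"

definition simplex_space :: "real \<Rightarrow> 'm::finite state measure" where
  "simplex_space E = restrict_space borel (simplex_set E)"

definition chart :: "real \<Rightarrow> real ^ 'm \<Rightarrow> 'm::finite state" where
  "chart E x = (x, E - (\<Sum>i\<in>UNIV. x $ i))"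

text \<open>Lebesgue measure on the simplex, in the coordinates given by the particle energies.\<close>

definition simplex_lebesgue :: "real \<Rightarrow> 'm::finite state measure" where
  "simplex_lebesgue E =
     distr (restrict_space lborel {x. chart E x \<in> simplex_set E}) (simplex_space E) (chart E)"

definition equilibrium :: "real \<Rightarrow> 'm::finite state measure" where
  "equilibrium E =
     (let Z = (\<integral>z. snd z powr (- 1 / 2) \<partial>(simplex_lebesgue E :: 'm state measure))
      in density (simplex_lebesgue E) (\<lambda>z. ennreal (1 / Z * snd z powr (- 1 / 2))))"

text \<open>
  The process is built explicitly from i.i.d. noise. For each ring the noise provides a unit-rate
  exponential variable per particle and the uniform variable used in the energy exchange. A clock
  of rate \<open>r\<close> is a unit exponential divided by \<open>r\<close>; the particle whose clock is the first to
  expire rings. All clocks are started afresh after each ring: exponential clocks are memoryless,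
  so this is what independence of the history amounts to.
\<close>

type_synonym 'm noise = "('m \<Rightarrow> real) \<times> real"

definition noise :: "'m::finite noise measure" where
  "noise = (\<Pi>\<^sub>M i\<in>UNIV. density lborel (\<lambda>s. ennreal (exponential_density 1 s)))
             \<Otimes>\<^sub>M restrict_space lborel {0<..<1}"

definition clock :: "'m::finite state \<Rightarrow> ('m \<Rightarrow> real) \<Rightarrow> 'm \<Rightarrow> real" where
  "clock z e i = e i / sqrt (fst z $ i)"

definition waiting_time :: "'m::finite state \<Rightarrow> ('m \<Rightarrow> real) \<Rightarrow> real" where
  "waiting_time z e = Min (range (clock z e))"

text \<open>Ties occur with probability zero, so the choice made by \<^const>\<open>arg_min_on\<close> is immaterial.\<close>

definition ringing :: "'m::finite state \<Rightarrow> ('m \<Rightarrow> real) \<Rightarrow> 'm" where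
  "ringing z e = arg_min_on (clock z e) UNIV"

definition exchange :: "'m::finite \<Rightarrow> real \<Rightarrow> 'm state \<Rightarrow> 'm state" where
  "exchange i u z =
     ((\<chi> j. if j = i then snd z + (1 - u\<^sup>2) * fst z $ i else fst z $ j), u\<^sup>2 * fst z $ i)"

text \<open>\<open>chain z \<omega> n\<close> is the state immediately after the \<open>n\<close>-th ring, which occurs at
  \<open>ring_time z \<omega> n\<close>.\<close>

primrec chain :: "'m::finite state \<Rightarrow> 'm noise stream \<Rightarrow> nat \<Rightarrow> 'm state" where
  "chain z \<omega> 0 = z"
| "chain z \<omega> (Suc n) =
     exchange (ringing (chain z \<omega> n) (fst (\<omega> !! n))) (snd (\<omega> !! n)) (chain z \<omega> n)"

primrec ring_time :: "'m::finite state \<Rightarrow> 'm noise stream \<Rightarrow> nat \<Rightarrow> real" where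
  "ring_time z \<omega> 0 = 0"
| "ring_time z \<omega> (Suc n) = ring_time z \<omega> n + waiting_time (chain z \<omega> n) (fst (\<omega> !! n))"

text \<open>
  At a ring time the process still has its old value, the new one being the right limit. The rates
  are bounded on the simplex, so almost surely the ring times tend to infinity and the minimum
  below exists.
\<close>

definition process :: "'m::finite state \<Rightarrow> real \<Rightarrow> 'm noise stream \<Rightarrow> 'm state" where
  "process z t \<omega> = chain z \<omega> (LEAST n. t \<le> ring_time z \<omega> (Suc n))"

definition transition :: "real \<Rightarrow> real \<Rightarrow> 'm::finite state \<Rightarrow> 'm state measure" where
  "transition E t z = distr (stream_space noise) (simplex_space E) (process z t)"

definition prob_on_simplex :: "real \<Rightarrow> 'm::finite state measure \<Rightarrow> bool" where
  "prob_on_simplex E \<mu> \<longleftrightarrow> prob_space \<mu> \<and> sets \<mu> = sets (simplex_space E)"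

text \<open>The value of \<open>\<mu>P\<^sup>t\<close> on \<open>A\<close>.\<close>

definition evolved :: "real \<Rightarrow> 'm::finite state measure \<Rightarrow> real \<Rightarrow> 'm state set \<Rightarrow> ennreal" where
  "evolved E \<mu> t A = (\<integral>\<^sup>+z. emeasure (transition E t z) A \<partial>\<mu>)"

definition invariant_prob :: "real \<Rightarrow> 'm::finite state measure \<Rightarrow> bool" where
  "invariant_prob E \<mu> \<longleftrightarrow> prob_on_simplex E \<mu> \<and>
     (\<forall>t>0. \<forall>A\<in>sets (simplex_space E). evolved E \<mu> t A = emeasure \<mu> A)"

text \<open>An invariant probability measure is ergodic if every almost surely invariant set is trivial.\<close>

definition ergodic_prob :: "real \<Rightarrow> 'm::finite state measure \<Rightarrow> bool" where
  "ergodic_prob E \<mu> \<longleftrightarrow> invariant_prob E \<mu> \<and>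
     (\<forall>A\<in>sets (simplex_space E).
        (\<forall>t>0. AE z in \<mu>. emeasure (transition E t z) A = indicator A z) \<longrightarrow>
        emeasure \<mu> A = 0 \<or> emeasure \<mu> A = 1)"

end

theory Submission imports Defs begin

text \<open>
  A ring of particle \<open>i\<close> preserves the pair energy \<open>S = x\<^sub>i + y\<close> and every other \<open>x\<^sub>j\<close>, so it
  moves the state along a line, on which \<open>x\<^sub>i\<close> serves as a coordinate in \<open>(0, S)\<close>. In this
  coordinate, the rate \<open>sqrt x\<^sub>i\<close> times the law of the new value \<open>S - u\<^sup>2 x\<^sub>i\<close> has the
  density \<open>1 / (2 sqrt (S - t))\<close> on \<open>(S - x\<^sub>i, S)\<close>; the substitution \<open>t = S - u\<^sup>2 x\<^sub>i\<close> makes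
  the rate cancel (\<open>nn_integral_exchanged_energy\<close>). Both halves of the theorem rest on this.

  Invariance. The density \<open>1 / sqrt (S - x)\<close> on the line is stationary for the rings of the
  particle \<open>i\<close> alone: the inflow at \<open>t\<close> is the integral of \<open>1 / sqrt (S - x)\<close> over
  \<open>(S - t, S)\<close> times \<open>1 / (2 sqrt (S - t))\<close>, that is \<open>sqrt t / sqrt (S - t)\<close>, which is the
  outflow (\<open>balance_on_line\<close>). Summing over the particles gives the balance of the total gain and
  the total loss under the equilibrium (\<open>equilibrium_balance\<close>). To pass from rates to transition
  probabilities, a path is decomposed at its first ring. As the rates are bounded, the ring times
  have no finite limit (\<open>explosion_zero\<close>), and this yields the backward equation
  (\<open>backward_equation\<close>). Integrated in time it says that \<open>P\<^sup>t f - f\<close> is the time integral of gain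
  minus loss (\<open>integrated_backward_equation\<close>), and the latter has mean zero under the equilibrium.

  Irreducibility. If \<open>A\<close> has positive equilibrium measure, then \<open>P\<^sup>t(z, A) > 0\<close> for every state
  \<open>z\<close> and every \<open>t > 0\<close> (\<open>irreducible\<close>). Let \<open>D\<close> be the set of the states from which \<open>A\<close> is hit with
  positive probability at all positive times. By the form of the jump density, \<open>z\<close> belongs to \<open>D\<close>
  as soon as \<open>D\<close> meets the upper segment \<open>(S - x\<^sub>i, S)\<close> of a line through \<open>z\<close> in a set of positive
  measure. If \<open>D\<close> meets a line in a set of positive measure, then it contains the part of the line
  near \<open>S\<close>, since from there almost the whole line is accessible; but that part is accessible from
  everywhere on the line, so \<open>D\<close> contains the whole line (\<open>reaching_line\<close>). Starting from \<open>A\<close> and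
  releasing one coordinate after another, Fubini's theorem puts into \<open>D\<close> all states with little
  energy in the particles (\<open>section_mass_reaching\<close>), and moving along lines once more gives all
  states (\<open>reaching_extend\<close>).

  Uniqueness and ergodicity. Let \<open>Y\<close> be a Hahn set for the difference of two invariant measures.
  Each of them balances the flux from \<open>Y\<close> to its complement against the flux back
  (\<open>stationary_flux_balance\<close>). The measure that is larger on \<open>Y\<close> has the larger flux out of \<open>Y\<close> and
  the smaller flux into it, in the weak sense, so the fluxes are the same for both. One of \<open>Y\<close> and its complement has
  positive equilibrium measure and is thus reached with positive probability from everywhere, and
  then equal fluxes force equal measures (\<open>stationary_measures_eq\<close>). Ergodicity is immediate:
  an almost surely invariant set of positive measure has a complement from which it is reached with
  positive probability, so that this complement is null.
\<close>

section \<open>Exponential clocks\<close>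

abbreviation unit_exponential :: "real measure" where
  "unit_exponential \<equiv> density lborel (\<lambda>s. ennreal (exponential_density 1 s))"

abbreviation clock_space :: "('m::finite \<Rightarrow> real) measure" where
  "clock_space \<equiv> \<Pi>\<^sub>M i\<in>UNIV. unit_exponential"

interpretation unit_exponential: prob_space unit_exponential
  by (rule prob_space_exponential_density) simp

interpretation unit_exponentials: product_prob_space "\<lambda>_::'m::finite. unit_exponential" UNIV
  by standard

lemma emeasure_unit_exponential_tail:
  assumes "0 \<le> a"
  shows "emeasure unit_exponential {a<..} = ennreal (exp (- a))"
proof -
  have "distributed unit_exponential lborel (\<lambda>x. x) (exponential_density 1)"
    unfolding distributed_def by (auto intro!: measure_eqI simp: emeasure_distr)
  from unit_exponential.exponential_distributedD_gt[OF this assms]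
  have "measure unit_exponential {a<..} = exp (- a)"
    by (simp add: greaterThan_def)
  then show ?thesis by (simp add: unit_exponential.emeasure_eq_measure)
qed

lemma nn_integral_exponential:
  fixes c :: real assumes "0 < c"
  shows "(\<integral>\<^sup>+s. ennreal (c * exp (- (c * s))) * indicator {0<..} s \<partial>lborel) = 1"
proof -
  interpret prob_space "density lborel (exponential_density c)"
    by (rule prob_space_exponential_density) fact
  have "(\<integral>\<^sup>+s. ennreal (c * exp (- (c * s))) * indicator {0<..} s \<partial>lborel)
    = (\<integral>\<^sup>+s. ennreal (exponential_density c s) \<partial>lborel)"
    by (intro nn_integral_cong_AE, use AE_lborel_singleton[of 0] in eventually_elim)
      (auto simp: exponential_density_def mult.commute split: split_indicator)
  also have "\<dots> = 1"
    using emeasure_space_1 by (simp add: emeasure_density)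
  finally show ?thesis .
qed

text \<open>
  The leader is required to be strict, so that the events of the particles being the leader are
  disjoint. That their probabilities add up to one then disposes of ties.
\<close>

definition leads :: "('m \<Rightarrow> real) \<Rightarrow> 'm \<Rightarrow> bool" where
  "leads c i \<longleftrightarrow> (\<forall>j. j \<noteq> i \<longrightarrow> c i < c j)"

lemma borel_measurable_component:
  "(\<lambda>e. e i) \<in> borel_measurable (clock_space :: ('m::finite \<Rightarrow> real) measure)"
  by (rule measurable_compose[OF measurable_component_singleton]) auto

lemma sets_leads[measurable]:
  "{e. leads (\<lambda>j. e j / r j) i} \<in> sets (clock_space :: ('m::finite \<Rightarrow> real) measure)"
proof -
  note [measurable] = borel_measurable_component
  have "{e \<in> space clock_space. leads (\<lambda>j. e j / r j) i} \<in> sets (clock_space :: ('m \<Rightarrow> real) measure)"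
    unfolding leads_def by measurable
  then show ?thesis by (simp add: space_PiM)
qed

text \<open>
  Given that the clock of \<open>i\<close> expires at time \<open>s\<close>, each other clock is later with probability
  \<open>exp (- r j * s)\<close>, independently. Together with the density of the clock of \<open>i\<close> itself this makes
  the winning time exponential with the sum of the rates, for every winner.
\<close>

lemma exponential_race:
  fixes r :: "'m::finite \<Rightarrow> real"
  assumes r: "\<And>i. 0 < r i" and [measurable]: "h \<in> borel_measurable borel"
  shows "(\<integral>\<^sup>+e. indicator {e. leads (\<lambda>j. e j / r j) i} e * h (e i / r i) \<partial>clock_space)
    = (\<integral>\<^sup>+s. ennreal (r i * exp (- (sum r UNIV * s))) * h s * indicator {0<..} s \<partial>lborel)"
proof -
  note [measurable] = borel_measurable_component
  let ?J = "UNIV - {i}"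
  have U: "insert i ?J = UNIV" by auto
  \<comment> \<open>The clocks other than the one of \<open>i\<close>, with the variable of \<open>i\<close> held at \<open>y\<close>.\<close>
  have inner: "(\<integral>\<^sup>+x. indicator {e. leads (\<lambda>j. e j / r j) i} (x(i := y)) * h ((x(i := y)) i / r i)
        \<partial>Pi\<^sub>M ?J (\<lambda>_. unit_exponential))
      = h (y / r i) * ennreal (exp (- (sum r ?J * (y / r i))))" (is "?L = _") if "0 \<le> y" for y
  proof -
    have "?L = (\<integral>\<^sup>+x. h (y / r i) * indicator (\<Pi>\<^sub>E j\<in>?J. {r j * (y / r i)<..}) x \<partial>Pi\<^sub>M ?J (\<lambda>_. unit_exponential))"
      using r by (intro nn_integral_cong)
        (auto simp: leads_def space_PiM PiE_iff extensional_def field_simps split: split_indicator)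
    also have "\<dots> = h (y / r i) * emeasure (Pi\<^sub>M ?J (\<lambda>_. unit_exponential)) (\<Pi>\<^sub>E j\<in>?J. {r j * (y / r i)<..})"
      by (intro nn_integral_cmult_indicator sets_PiM_I_finite) auto
    also have "emeasure (Pi\<^sub>M ?J (\<lambda>_. unit_exponential)) (\<Pi>\<^sub>E j\<in>?J. {r j * (y / r i)<..})
      = (\<Prod>j\<in>?J. ennreal (exp (- (r j * (y / r i)))))"
      using r that less_imp_le[OF r]
      by (subst unit_exponentials.emeasure_PiM) (auto intro!: prod.cong emeasure_unit_exponential_tail)
    also have "\<dots> = ennreal (exp (- (sum r ?J * (y / r i))))"
      by (simp add: prod_ennreal exp_sum[symmetric] sum_negf sum_distrib_right sum_divide_distrib)
    finally show ?thesis .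
  qed
  have "(\<integral>\<^sup>+e. indicator {e. leads (\<lambda>j. e j / r j) i} e * h (e i / r i) \<partial>clock_space)
    = (\<integral>\<^sup>+e. indicator {e. leads (\<lambda>j. e j / r j) i} e * h (e i / r i) \<partial>Pi\<^sub>M (insert i ?J) (\<lambda>_. unit_exponential))"
    by (simp add: U)
  also have "\<dots> = (\<integral>\<^sup>+y. (\<integral>\<^sup>+x. indicator {e. leads (\<lambda>j. e j / r j) i} (x(i := y)) * h ((x(i := y)) i / r i)
        \<partial>Pi\<^sub>M ?J (\<lambda>_. unit_exponential)) \<partial>unit_exponential)"
  proof (intro unit_exponentials.product_nn_integral_insert_rev)
    show "(\<lambda>e. indicator {e. leads (\<lambda>j. e j / r j) i} e * h (e i / r i))
      \<in> borel_measurable (Pi\<^sub>M (insert i ?J) (\<lambda>_. unit_exponential))"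
      unfolding U by measurable
  qed auto
  also have "\<dots> = (\<integral>\<^sup>+y. h (y / r i) * ennreal (exp (- (sum r ?J * (y / r i)))) \<partial>unit_exponential)"
  proof (intro nn_integral_cong_AE)
    have "AE y in unit_exponential. 0 \<le> y"
      by (subst AE_density) (auto simp: exponential_density_def)
    then show "AE y in unit_exponential. (\<integral>\<^sup>+x. indicator {e. leads (\<lambda>j. e j / r j) i} (x(i := y)) * h ((x(i := y)) i / r i)
        \<partial>Pi\<^sub>M ?J (\<lambda>_. unit_exponential)) = h (y / r i) * ennreal (exp (- (sum r ?J * (y / r i))))"
      by eventually_elim (rule inner)
  qed
  also have "\<dots> = (\<integral>\<^sup>+y. ennreal (exponential_density 1 y) * (h (y / r i) * ennreal (exp (- (sum r ?J * (y / r i))))) \<partial>lborel)"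
    by (subst nn_integral_density) auto
  also have "\<dots> = ennreal \<bar>r i\<bar> * (\<integral>\<^sup>+s. ennreal (exponential_density 1 (0 + r i * s))
      * (h ((0 + r i * s) / r i) * ennreal (exp (- (sum r ?J * ((0 + r i * s) / r i))))) \<partial>lborel)"
    using r[of i] by (subst nn_integral_real_affine[where c = "r i" and t = 0]) auto
  also have "\<dots> = (\<integral>\<^sup>+s. ennreal (r i) * (ennreal (exponential_density 1 (r i * s))
      * (h s * ennreal (exp (- (sum r ?J * s))))) \<partial>lborel)"
    using r[of i] by (subst nn_integral_cmult) auto
  also have "\<dots> = (\<integral>\<^sup>+s. ennreal (r i * exp (- (sum r UNIV * s))) * h s * indicator {0<..} s \<partial>lborel)"
  proof (intro nn_integral_cong_AE, use AE_lborel_singleton[of 0] in eventually_elim)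
    fix s :: real assume "s \<noteq> 0"
    have *: "sum r UNIV = r i + sum r ?J" by (subst U[symmetric], subst sum.insert) auto
    have "exp (- (sum r UNIV * s)) = exp (- (r i * s)) * exp (- (sum r ?J * s))"
      unfolding * by (simp add: exp_add[symmetric] algebra_simps)
    then show "ennreal (r i) * (ennreal (exponential_density 1 (r i * s)) * (h s * ennreal (exp (- (sum r ?J * s)))))
      = ennreal (r i * exp (- (sum r UNIV * s))) * h s * indicator {0<..} s"
      using r[of i] \<open>s \<noteq> 0\<close>
      by (auto simp: exponential_density_def zero_less_mult_iff mult_less_0_iff ennreal_mult' mult_ac split: split_indicator)
  qed
  finally show ?thesis .
qed

text \<open>
  Particle \<open>i\<close> leads with probability \<open>r i / sum r UNIV\<close>; these numbers sum to one.
\<close>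

lemma AE_exponential_race_leader:
  fixes r :: "'m::finite \<Rightarrow> real"
  assumes r: "\<And>i. 0 < r i"
  shows "AE e in clock_space. \<exists>i. leads (\<lambda>j. e j / r j) i"
proof -
  have pos: "0 < sum r UNIV" using r by (intro sum_pos) auto
  have 1: "emeasure clock_space {e. leads (\<lambda>j. e j / r j) i} = ennreal (r i / sum r UNIV)" for i
  proof -
    have "emeasure clock_space {e. leads (\<lambda>j. e j / r j) i}
      = (\<integral>\<^sup>+e. indicator {e. leads (\<lambda>j. e j / r j) i} e * 1 \<partial>clock_space)"
      using sets_leads by simp
    also have "\<dots> = (\<integral>\<^sup>+s. ennreal (r i * exp (- (sum r UNIV * s))) * 1 * indicator {0<..} s \<partial>lborel)"
      by (rule exponential_race[OF r]) auto
    also have "\<dots> = (\<integral>\<^sup>+s. ennreal (r i / sum r UNIV)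
        * (ennreal (sum r UNIV * exp (- (sum r UNIV * s))) * indicator {0<..} s) \<partial>lborel)"
      using less_imp_le[OF r] pos
      by (intro nn_integral_cong) (simp add: ennreal_mult[symmetric] mult.assoc[symmetric])
    also have "\<dots> = ennreal (r i / sum r UNIV)"
      by (simp add: nn_integral_cmult nn_integral_exponential[OF pos])
    finally show ?thesis .
  qed
  have disj: "disjoint_family (\<lambda>i. {e. leads (\<lambda>j. e j / r j) i})"
    by (auto simp: disjoint_family_on_def leads_def) (metis order_less_asym)
  have "emeasure clock_space (\<Union>i. {e. leads (\<lambda>j. e j / r j) i}) = (\<Sum>i\<in>UNIV. ennreal (r i / sum r UNIV))"
    using disj by (subst sum_emeasure[symmetric]) (auto simp: 1)
  also have "\<dots> = 1"
    using r pos less_imp_le[OF r] by (subst sum_ennreal) (auto simp: sum_divide_distrib[symmetric])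
  finally have "AE e in clock_space. e \<in> (\<Union>i. {e. leads (\<lambda>j. e j / r j) i})"
    by (intro unit_exponentials.AE_in_set_eq_1[THEN iffD2]) (auto simp: unit_exponentials.emeasure_eq_measure)
  then show ?thesis by simp
qed


section \<open>The law of the first ring\<close>

lemma borel_measurable_fst_vec_nth[measurable]:
  "(\<lambda>z::'m::finite state. fst z $ i) \<in> borel_measurable borel"
  by (intro borel_measurable_continuous_onI continuous_intros)

lemma borel_measurable_snd_state[measurable]:
  "(snd :: 'm::finite state \<Rightarrow> real) \<in> borel_measurable borel"
  by (intro borel_measurable_continuous_onI continuous_intros)

lemma measurable_clock[measurable]:
  "(\<lambda>p. clock (fst p) (snd p) i) \<in> borel_measurable (borel \<Otimes>\<^sub>M (clock_space :: ('m::finite \<Rightarrow> real) measure))"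
proof -
  have 1: "(\<lambda>z::'m state. sqrt (fst z $ i)) \<in> borel_measurable borel"
    by measurable
  show ?thesis
    unfolding clock_def
    by (intro borel_measurable_divide
        measurable_compose[OF measurable_snd borel_measurable_component] measurable_compose[OF measurable_fst 1])
qed

text \<open>
  The choice made by \<^const>\<open>arg_min_on\<close> at a tie is arbitrary, but it depends only on the set of the
  particles whose clocks are the first to expire, which takes finitely many values.
\<close>

lemma measurable_ringing[measurable]:
  "(\<lambda>p. ringing (fst p) (snd p)) \<in> borel \<Otimes>\<^sub>M (clock_space :: ('m::finite \<Rightarrow> real) measure) \<rightarrow>\<^sub>M count_space UNIV"
proof -
  let ?M = "borel \<Otimes>\<^sub>M (clock_space :: ('m \<Rightarrow> real) measure)"
  define first where "first p = {i. \<forall>j. clock (fst p) (snd p) i \<le> clock (fst p) (snd p) j}"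
    for p :: "'m state \<times> ('m \<Rightarrow> real)"
  have ringing_eq: "ringing (fst p) (snd p) = (SOME i. i \<in> first p)" for p :: "'m state \<times> ('m \<Rightarrow> real)"
    by (simp add: ringing_def arg_min_on_def arg_min_def is_arg_min_def first_def not_less)
  have "first \<in> ?M \<rightarrow>\<^sub>M count_space UNIV"
  proof (subst measurable_count_space_eq2_countable, safe)
    fix S :: "'m set"
    have "{p \<in> space ?M. \<forall>i. i \<in> S \<longleftrightarrow> (\<forall>j. clock (fst p) (snd p) i \<le> clock (fst p) (snd p) j)} \<in> sets ?M"
      by measurable
    also have "{p \<in> space ?M. \<forall>i. i \<in> S \<longleftrightarrow> (\<forall>j. clock (fst p) (snd p) i \<le> clock (fst p) (snd p) j)} = first -` {S} \<inter> space ?M"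
      by (auto simp: first_def)
    finally show "first -` {S} \<inter> space ?M \<in> sets ?M" .
  qed (auto intro: countable_finite)
  then show ?thesis
    unfolding ringing_eq by (rule measurable_compose) simp
qed

lemma measurable_waiting_time[measurable]:
  "(\<lambda>p. waiting_time (fst p) (snd p)) \<in> borel_measurable (borel \<Otimes>\<^sub>M (clock_space :: ('m::finite \<Rightarrow> real) measure))"
  unfolding waiting_time_def by (intro borel_measurable_Min) (auto intro: measurable_clock)

abbreviation unit_uniform :: "real measure" where
  "unit_uniform \<equiv> restrict_space lborel {0<..<1}"

interpretation unit_uniform: prob_space unit_uniform
  by (rule prob_spaceI) (simp add: emeasure_restrict_space)

lemma emeasure_unit_uniform_interval[simp]: "emeasure unit_uniform {0<..<1} = 1"
  by (simp add: emeasure_restrict_space)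

interpretation noise: prob_space "noise :: 'm::finite noise measure"
  unfolding noise_def
  by (intro prob_space_pair unit_exponentials.prob_space_axioms unit_uniform.prob_space_axioms)

lemma measurable_fst_noise[measurable]: "fst \<in> noise \<rightarrow>\<^sub>M (clock_space :: ('m::finite \<Rightarrow> real) measure)"
  unfolding noise_def by measurable

lemma measurable_snd_noise_unit: "snd \<in> (noise :: 'm::finite noise measure) \<rightarrow>\<^sub>M unit_uniform"
  unfolding noise_def by measurable

lemma measurable_snd_noise[measurable]: "snd \<in> borel_measurable (noise :: 'm::finite noise measure)"
  using measurable_snd_noise_unit by (auto simp: measurable_restrict_space2_iff)

lemma leads_ringing:
  assumes "leads (clock z e) i"
  shows "ringing z e = i" "waiting_time z e = clock z e i"
proof -
  have le: "clock z e i \<le> clock z e j" for j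
    using assms by (cases "j = i") (auto simp: leads_def)
  show "ringing z e = i"
    unfolding ringing_def arg_min_on_def arg_min_def
  proof (rule some_equality)
    show "is_arg_min (clock z e) (\<lambda>x. x \<in> UNIV) i"
      using le by (auto simp: is_arg_min_def not_less)
    show "j = i" if "is_arg_min (clock z e) (\<lambda>x. x \<in> UNIV) j" for j
      using that assms by (auto simp: is_arg_min_def leads_def)
  qed
  show "waiting_time z e = clock z e i"
    unfolding waiting_time_def using le by (intro Min_eqI) auto
qed

definition total_rate :: "'m::finite state \<Rightarrow> real" where
  "total_rate z = (\<Sum>i\<in>UNIV. sqrt (fst z $ i))"

text \<open>
  The joint law of the ringing particle, the waiting time and the exchange variable.
\<close>

lemma nn_integral_first_ring:
  fixes z :: "'m::finite state" and h :: "'m \<Rightarrow> real \<Rightarrow> real \<Rightarrow> ennreal"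
  assumes z: "\<And>i. 0 < fst z $ i"
    and h[measurable]: "\<And>i. (\<lambda>p. h i (fst p) (snd p)) \<in> borel_measurable (borel \<Otimes>\<^sub>M unit_uniform)"
  shows "(\<integral>\<^sup>+x. h (ringing z (fst x)) (waiting_time z (fst x)) (snd x) \<partial>noise)
    = (\<Sum>i\<in>UNIV. \<integral>\<^sup>+s. ennreal (sqrt (fst z $ i) * exp (- (total_rate z * s)))
        * (\<integral>\<^sup>+u. h i s u \<partial>unit_uniform) * indicator {0<..} s \<partial>lborel)"
proof -
  define r where "r i = sqrt (fst z $ i)" for i
  have r: "0 < r i" for i using z by (simp add: r_def)
  define H where "H i s = (\<integral>\<^sup>+u. h i s u \<partial>unit_uniform)" for i s
  have [measurable]: "H i \<in> borel_measurable borel" for i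
    unfolding H_def using h[of i] by (intro unit_uniform.borel_measurable_nn_integral) (simp add: case_prod_beta')
  have ring[measurable]: "ringing z \<in> clock_space \<rightarrow>\<^sub>M count_space UNIV"
    using measurable_compose_Pair1[of z borel "\<lambda>p. ringing (fst p) (snd p)" clock_space "count_space UNIV"] by simp
  have wait[measurable]: "waiting_time z \<in> borel_measurable clock_space"
    using measurable_compose_Pair1[of z borel "\<lambda>p. waiting_time (fst p) (snd p)" clock_space borel] by simp
  have clk: "clock z e = (\<lambda>j. e j / r j)" for e by (auto simp: clock_def r_def)
  have hm[measurable]: "(\<lambda>x. h (ringing z (fst x)) (waiting_time z (fst x)) (snd x)) \<in> borel_measurable (clock_space \<Otimes>\<^sub>M unit_uniform)"
  proof (rule measurable_compose_countable[where g = "\<lambda>x. ringing z (fst x)"])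
    show "(\<lambda>x. h i (waiting_time z (fst x)) (snd x)) \<in> borel_measurable (clock_space \<Otimes>\<^sub>M unit_uniform)" for i
      using measurable_compose[OF _ h[of i], of "\<lambda>x. (waiting_time z (fst x), snd x)" "clock_space \<Otimes>\<^sub>M unit_uniform"]
      by simp
    show "(\<lambda>x. ringing z (fst x)) \<in> clock_space \<Otimes>\<^sub>M unit_uniform \<rightarrow>\<^sub>M count_space UNIV"
      by measurable
  qed
  have "(\<integral>\<^sup>+x. h (ringing z (fst x)) (waiting_time z (fst x)) (snd x) \<partial>noise)
    = (\<integral>\<^sup>+e. H (ringing z e) (waiting_time z e) \<partial>clock_space)"
    unfolding noise_def H_def by (subst unit_uniform.nn_integral_fst[symmetric]) (use hm in auto)
  also have "\<dots> = (\<integral>\<^sup>+e. (\<Sum>i\<in>UNIV. indicator {e. leads (\<lambda>j. e j / r j) i} e * H i (e i / r i)) \<partial>clock_space)"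
  proof (rule nn_integral_cong_AE, rule eventually_mono[OF AE_exponential_race_leader[OF r]])
    fix e assume "\<exists>i. leads (\<lambda>j. e j / r j) i"
    then obtain i where i: "leads (\<lambda>j. e j / r j) i" by auto
    have "indicator {e. leads (\<lambda>j. e j / r j) k} e = (if k = i then 1 else 0::ennreal)" for k
      using i by (auto simp: leads_def split: split_indicator) (metis order_less_asym)
    then have "(\<Sum>k\<in>UNIV. indicator {e. leads (\<lambda>j. e j / r j) k} e * H k (e k / r k))
      = (\<Sum>k\<in>UNIV. if k = i then H i (e i / r i) else 0)"
      by (intro sum.cong) auto
    then show "H (ringing z e) (waiting_time z e)
        = (\<Sum>k\<in>UNIV. indicator {e. leads (\<lambda>j. e j / r j) k} e * H k (e k / r k))"
      using leads_ringing[of z e i] i by (simp add: clk)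
  qed
  also have "\<dots> = (\<Sum>i\<in>UNIV. \<integral>\<^sup>+e. indicator {e. leads (\<lambda>j. e j / r j) i} e * H i (e i / r i) \<partial>clock_space)"
    by (intro nn_integral_sum borel_measurable_times_ennreal borel_measurable_indicator sets_leads borel_measurable_component
        measurable_compose[where f = "\<lambda>e. e _ / r _" and g = "H _" and N = borel]) measurable
  also have "\<dots> = (\<Sum>i\<in>UNIV. \<integral>\<^sup>+s. ennreal (r i * exp (- (sum r UNIV * s))) * H i s * indicator {0<..} s \<partial>lborel)"
    by (intro sum.cong refl exponential_race r) measurable
  finally show ?thesis by (simp add: H_def r_def total_rate_def)
qed

section \<open>Measurability of the process\<close>

abbreviation paths :: "'m::finite noise stream measure" where
  "paths \<equiv> stream_space noise"

interpretation paths: prob_space "paths :: 'm::finite noise stream measure"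
  by (rule noise.prob_space_stream_space)

lemma nn_integral_exponential_interval:
  fixes c :: real assumes "0 \<le> c" "a \<le> t"
  shows "(\<integral>\<^sup>+s. ennreal (c * exp (- (c * (s - a)))) * indicator {a<..<t} s \<partial>lborel) = ennreal (1 - exp (- (c * (t - a))))"
proof -
  have "(\<integral>\<^sup>+s. ennreal (c * exp (- (c * (s - a)))) * indicator {a<..<t} s \<partial>lborel)
    = (\<integral>\<^sup>+s. ennreal (c * exp (- (c * (s - a)))) * indicator {a..t} s \<partial>lborel)"
    by (intro nn_integral_cong_AE, use AE_lborel_singleton[of a] AE_lborel_singleton[of t] in eventually_elim)
      (auto split: split_indicator)
  also have "\<dots> = ennreal (- exp (- (c * (t - a))) - (- exp (- (c * (a - a)))))"
    using assms by (intro nn_integral_FTC_Icc) (auto intro!: derivative_eq_intros)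
  finally show ?thesis by simp
qed

lemma measurable_exchange:
  "(\<lambda>p. exchange i (fst p) (snd p)) \<in> (borel \<Otimes>\<^sub>M borel :: (real \<times> 'm::finite state) measure) \<rightarrow>\<^sub>M borel"
proof -
  have "continuous_on UNIV (\<lambda>p::real \<times> 'm state. exchange i (fst p) (snd p))"
    unfolding exchange_def
  proof (intro continuous_on_Pair continuous_on_vec_lambda)
    show "continuous_on UNIV (\<lambda>p::real \<times> 'm state. if j = i then snd (snd p) + (1 - (fst p)\<^sup>2) * fst (snd p) $ i else fst (snd p) $ j)" for j
      by (cases "j = i") (auto intro!: continuous_intros)
  qed (intro continuous_intros)
  then show ?thesis
    by (simp add: borel_prod borel_measurable_continuous_onI)
qed

lemma measurable_chain:
  "(\<lambda>p. chain (fst p) (snd p) n) \<in> borel \<Otimes>\<^sub>M paths \<rightarrow>\<^sub>M (borel :: 'm::finite state measure)"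
proof (induction n)
  case (Suc n)
  note [measurable] = Suc.IH
  have 1: "(\<lambda>p. (chain (fst p) (snd p) n, fst (snd p !! n))) \<in> borel \<Otimes>\<^sub>M paths \<rightarrow>\<^sub>M borel \<Otimes>\<^sub>M (clock_space :: ('m \<Rightarrow> real) measure)"
    by measurable
  have 2: "(\<lambda>p. (snd (snd p !! n), chain (fst p) (snd p) n)) \<in> borel \<Otimes>\<^sub>M (paths :: 'm noise stream measure) \<rightarrow>\<^sub>M borel \<Otimes>\<^sub>M borel"
    by measurable
  show ?case
    unfolding chain.simps
  proof (rule measurable_compose_countable[where f = "\<lambda>i p. exchange i (snd (snd p !! n)) (chain (fst p) (snd p) n)"])
    show "(\<lambda>p. ringing (chain (fst p) (snd p) n) (fst (snd p !! n))) \<in> borel \<Otimes>\<^sub>M (paths :: 'm noise stream measure) \<rightarrow>\<^sub>M count_space UNIV"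
      using measurable_compose[OF 1 measurable_ringing] by simp
    show "(\<lambda>p. exchange i (snd (snd p !! n)) (chain (fst p) (snd p) n)) \<in> borel \<Otimes>\<^sub>M (paths :: 'm noise stream measure) \<rightarrow>\<^sub>M borel" for i
      using measurable_compose[OF 2 measurable_exchange[of i]] by simp
  qed
qed simp

lemma measurable_ring_time:
  "(\<lambda>p. ring_time (fst p) (snd p) n) \<in> borel_measurable (borel \<Otimes>\<^sub>M (paths :: 'm::finite noise stream measure))"
proof (induction n)
  case (Suc n)
  note [measurable] = measurable_chain[of n]
  have 1: "(\<lambda>p. (chain (fst p) (snd p) n, fst (snd p !! n))) \<in> borel \<Otimes>\<^sub>M paths \<rightarrow>\<^sub>M borel \<Otimes>\<^sub>M (clock_space :: ('m \<Rightarrow> real) measure)"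
    by measurable
  show ?case
    using Suc.IH measurable_compose[OF 1 measurable_waiting_time] by simp
qed simp

lemma measurable_process:
  "(\<lambda>q. process (snd (fst q)) (fst (fst q)) (snd q)) \<in> (borel \<Otimes>\<^sub>M borel) \<Otimes>\<^sub>M paths \<rightarrow>\<^sub>M (borel :: 'm::finite state measure)"
proof -
  let ?N = "(borel \<Otimes>\<^sub>M borel) \<Otimes>\<^sub>M paths :: ((real \<times> 'm state) \<times> 'm noise stream) measure"
  have zw: "(\<lambda>q. (snd (fst q), snd q)) \<in> ?N \<rightarrow>\<^sub>M borel \<Otimes>\<^sub>M paths"
    by measurable
  have [measurable]: "(\<lambda>q. ring_time (snd (fst q)) (snd q) n) \<in> borel_measurable ?N" for n
    using measurable_compose[OF zw measurable_ring_time] by simp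
  have [measurable]: "(\<lambda>q. chain (snd (fst q)) (snd q) n) \<in> ?N \<rightarrow>\<^sub>M borel" for n
    using measurable_compose[OF zw measurable_chain] by simp
  show ?thesis
    unfolding process_def by (rule measurable_compose_countable) measurable
qed

lemma measurable_process_path:
  "process z t \<in> paths \<rightarrow>\<^sub>M (borel :: 'm::finite state measure)"
  using measurable_compose[OF _ measurable_process, of "\<lambda>\<omega>. ((t, z), \<omega>)" paths] by simp

text \<open>
  The transition probability as a function on all pairs of a time and a state, without reference to
  the simplex, so that joint measurability can be stated over the Borel sets.
\<close>

definition occupation :: "'m::finite state set \<Rightarrow> real \<Rightarrow> 'm state \<Rightarrow> ennreal" where
  "occupation A t z = (\<integral>\<^sup>+\<omega>. indicator A (process z t \<omega>) \<partial>paths)"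

lemma measurable_occupation:
  assumes [measurable]: "A \<in> sets (borel :: 'm::finite state measure)"
  shows "(\<lambda>p. occupation A (fst p) (snd p)) \<in> borel_measurable (borel \<Otimes>\<^sub>M borel)"
proof -
  have "(\<lambda>q. indicator A (process (snd (fst q)) (fst (fst q)) (snd q)) :: ennreal) \<in> borel_measurable ((borel \<Otimes>\<^sub>M borel) \<Otimes>\<^sub>M paths)"
    using measurable_compose[OF measurable_process borel_measurable_indicator[OF assms]] by simp
  then show ?thesis
    unfolding occupation_def
    by (intro paths.borel_measurable_nn_integral) (simp add: case_prod_beta')
qed

definition explosion :: "real \<Rightarrow> 'm::finite state \<Rightarrow> ennreal" where
  "explosion t z = (\<integral>\<^sup>+\<omega>. indicator {\<omega>. \<forall>n. ring_time z \<omega> (Suc n) < t} \<omega> \<partial>paths)"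

lemma measurable_explosion_event:
  "(\<lambda>q. indicator {\<omega>. \<forall>n. ring_time (snd (fst q)) \<omega> (Suc n) < fst (fst q)} (snd q) :: ennreal)
    \<in> borel_measurable ((borel \<Otimes>\<^sub>M borel) \<Otimes>\<^sub>M (paths :: 'm::finite noise stream measure))"
proof -
  let ?N = "(borel \<Otimes>\<^sub>M borel) \<Otimes>\<^sub>M paths :: ((real \<times> 'm state) \<times> 'm noise stream) measure"
  have zw: "(\<lambda>q. (snd (fst q), snd q)) \<in> ?N \<rightarrow>\<^sub>M borel \<Otimes>\<^sub>M paths"
    by measurable
  have [measurable]: "(\<lambda>q. ring_time (snd (fst q)) (snd q) n) \<in> borel_measurable ?N" for n
    using measurable_compose[OF zw measurable_ring_time] by simp
  have 1: "(\<lambda>q. indicator {q \<in> space ?N. \<forall>n. ring_time (snd (fst q)) (snd q) (Suc n) < fst (fst q)} q :: ennreal)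
    \<in> borel_measurable ?N"
    by (intro borel_measurable_indicator) measurable
  have 2: "indicator {q \<in> space ?N. \<forall>n. ring_time (snd (fst q)) (snd q) (Suc n) < fst (fst q)} q
    = (indicator {\<omega>. \<forall>n. ring_time (snd (fst q)) \<omega> (Suc n) < fst (fst q)} (snd q) :: ennreal)"
    if "q \<in> space ?N" for q
    using that by (simp only: indicator_def mem_Collect_eq simp_thms)
  show ?thesis
    by (rule measurable_cong[THEN iffD1, OF _ 1]) (rule 2)
qed

lemma measurable_explosion:
  "(\<lambda>p. explosion (fst p) (snd p :: 'm::finite state)) \<in> borel_measurable (borel \<Otimes>\<^sub>M borel)"
  unfolding explosion_def using measurable_explosion_event
  by (intro paths.borel_measurable_nn_integral) (simp add: case_prod_beta')

section \<open>Transition probabilities on the simplex\<close>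

lemma exchange_in_simplex:
  assumes "z \<in> simplex_set E" "0 < u" "u < 1"
  shows "exchange i u z \<in> simplex_set E"
proof -
  obtain x y where z: "z = (x, y)" by force
  have x: "0 < x $ j" for j using assms by (auto simp: simplex_set_def z)
  have y: "0 < y" "y + (\<Sum>j\<in>UNIV. x $ j) = E" using assms by (auto simp: simplex_set_def z)
  have u: "u\<^sup>2 < 1" using assms by (simp add: power2_eq_square mult_strict_mono[of u 1 u 1, simplified])
  have "(\<Sum>j\<in>UNIV. if j = i then y + (1 - u\<^sup>2) * x $ i else x $ j) = y + (1 - u\<^sup>2) * x $ i + (\<Sum>j\<in>UNIV - {i}. x $ j)"
    by (subst sum.remove[of _ i]) auto
  moreover have "(\<Sum>j\<in>UNIV. x $ j) = x $ i + (\<Sum>j\<in>UNIV - {i}. x $ j)"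
    by (subst sum.remove[of _ i]) auto
  ultimately have sum: "u\<^sup>2 * x $ i + (\<Sum>j\<in>UNIV. if j = i then y + (1 - u\<^sup>2) * x $ i else x $ j) = E"
    using y(2) by (simp add: algebra_simps)
  have "0 < (1 - u\<^sup>2) * x $ i" "0 < u\<^sup>2 * x $ i"
    using x u assms(2) by simp_all
  then show ?thesis
    using x y(1) sum unfolding simplex_set_def exchange_def z fst_conv snd_conv by (simp add: add_pos_pos)
qed

lemma chain_in_simplex:
  assumes "z \<in> simplex_set E" "\<omega> \<in> space paths"
  shows "chain z \<omega> n \<in> simplex_set E"
proof (induction n)
  case (Suc n)
  have "\<omega> !! n \<in> space noise"
    using assms(2) by (auto simp: space_stream_space streams_iff_snth)
  then have "0 < snd (\<omega> !! n)" "snd (\<omega> !! n) < 1"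
    by (auto simp: noise_def space_pair_measure space_restrict_space)
  then show ?case using Suc by (auto intro!: exchange_in_simplex)
qed (use assms in simp)

lemma process_in_simplex:
  "z \<in> simplex_set E \<Longrightarrow> \<omega> \<in> space paths \<Longrightarrow> process z t \<omega> \<in> simplex_set E"
  unfolding process_def by (rule chain_in_simplex)

lemma simplex_set_borel[measurable]: "simplex_set E \<in> sets (borel :: 'm::finite state measure)"
proof -
  have "simplex_set E = {z \<in> space (borel :: 'm state measure).
      (\<forall>i. 0 < fst z $ i) \<and> 0 < snd z \<and> snd z + (\<Sum>i\<in>UNIV. fst z $ i) = E}"
    by (auto simp: simplex_set_def)
  also have "\<dots> \<in> sets borel"
    by measurable
  finally show ?thesis .
qed

lemma space_simplex_space[simp]: "space (simplex_space E) = simplex_set E"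
  by (simp add: simplex_space_def space_restrict_space)

lemma sets_simplex_space: "A \<in> sets (simplex_space E) \<longleftrightarrow> A \<in> sets borel \<and> A \<subseteq> simplex_set E"
  by (auto simp: simplex_space_def sets_restrict_space_iff)

lemma emeasure_transition:
  assumes "z \<in> simplex_set E" "A \<in> sets (simplex_space E)"
  shows "emeasure (transition E t z) A = occupation A t z"
proof -
  have m: "process z t \<in> paths \<rightarrow>\<^sub>M simplex_space E"
    unfolding simplex_space_def
    by (intro measurable_restrict_space2 measurable_process_path) (auto intro: process_in_simplex assms)
  have "emeasure (transition E t z) A = (\<integral>\<^sup>+x. indicator A x \<partial>transition E t z)"
    using assms by (simp add: transition_def)
  also have "\<dots> = occupation A t z"
    unfolding transition_def occupation_def using assms m by (intro nn_integral_distr) auto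
  finally show ?thesis .
qed

lemma total_rate_pos:
  "z \<in> simplex_set E \<Longrightarrow> 0 < total_rate (z :: 'm::finite state)"
  unfolding total_rate_def by (intro sum_pos) (auto simp: simplex_set_def)

lemma total_rate_le:
  assumes "z \<in> simplex_set E"
  shows "total_rate (z :: 'm::finite state) \<le> real CARD('m) * sqrt E"
proof -
  have "fst z $ i \<le> E" for i
  proof -
    have "fst z $ i \<le> (\<Sum>i\<in>UNIV. fst z $ i)"
      using assms by (intro member_le_sum) (auto simp: simplex_set_def less_imp_le)
    then show ?thesis using assms by (auto simp: simplex_set_def)
  qed
  then have "total_rate z \<le> (\<Sum>i\<in>(UNIV::'m set). sqrt E)"
    unfolding total_rate_def by (intro sum_mono) simp
  then show ?thesis by simp
qed

section \<open>Decomposition of a path at the first ring\<close>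

abbreviation after_ring :: "'m::finite state \<Rightarrow> 'm noise \<Rightarrow> 'm state" where
  "after_ring z x \<equiv> exchange (ringing z (fst x)) (snd x) z"

lemma chain_Stream: "chain z (x ## \<omega>) (Suc n) = chain (after_ring z x) \<omega> n"
  by (induction n) auto

lemma ring_time_Stream:
  "ring_time z (x ## \<omega>) (Suc n) = waiting_time z (fst x) + ring_time (after_ring z x) \<omega> n"
proof (induction n)
  case (Suc n)
  have "ring_time z (x ## \<omega>) (Suc (Suc n))
    = ring_time z (x ## \<omega>) (Suc n) + waiting_time (chain z (x ## \<omega>) (Suc n)) (fst (\<omega> !! n))"
    by (subst ring_time.simps(2)) simp
  also have "\<dots> = waiting_time z (fst x) + (ring_time (after_ring z x) \<omega> n + waiting_time (chain (after_ring z x) \<omega> n) (fst (\<omega> !! n)))"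
    unfolding Suc.IH chain_Stream by simp
  finally show ?case by simp
qed simp

lemma explosion_Stream:
  "(\<forall>n. ring_time z (x ## \<omega>) (Suc n) < t) \<longleftrightarrow>
    waiting_time z (fst x) < t \<and> (\<forall>n. ring_time (after_ring z x) \<omega> (Suc n) < t - waiting_time z (fst x))"
  (is "?L \<longleftrightarrow> ?R")
proof -
  have "?L \<longleftrightarrow> (\<forall>n. ring_time (after_ring z x) \<omega> n < t - waiting_time z (fst x))"
    by (simp only: ring_time_Stream less_diff_eq add.commute)
  also have "\<dots> \<longleftrightarrow> ring_time (after_ring z x) \<omega> 0 < t - waiting_time z (fst x)
      \<and> (\<forall>n. ring_time (after_ring z x) \<omega> (Suc n) < t - waiting_time z (fst x))"
    by (metis not0_implies_Suc)
  finally show ?thesis by simp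
qed

lemma process_Stream_before:
  assumes "t \<le> waiting_time z (fst x)"
  shows "process z t (x ## \<omega>) = z"
proof -
  have "(LEAST n. t \<le> ring_time z (x ## \<omega>) (Suc n)) = 0"
    using assms by (intro Least_eq_0) (simp del: ring_time.simps(2) add: ring_time_Stream)
  then show ?thesis by (simp add: process_def)
qed

text \<open>
  The second hypothesis matters: if the ring times stay below \<open>t\<close>, then \<^const>\<open>process\<close> refers to the
  least element of an empty set of numbers, and this unspecified number is not shifted by one when the
  first ring is removed.
\<close>

lemma process_Stream_after:
  assumes "waiting_time z (fst x) < t"
    and "\<not> (\<forall>n. ring_time (after_ring z x) \<omega> (Suc n) < t - waiting_time z (fst x))"
  shows "process z t (x ## \<omega>) = process (after_ring z x) (t - waiting_time z (fst x)) \<omega>"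
proof -
  let ?P = "\<lambda>n. t \<le> ring_time z (x ## \<omega>) (Suc n)"
  let ?Q = "\<lambda>n. t - waiting_time z (fst x) \<le> ring_time (after_ring z x) \<omega> (Suc n)"
  have PQ: "?P (Suc n) \<longleftrightarrow> ?Q n" for n
    by (subst ring_time_Stream) linarith
  from assms(2) obtain n where "?Q n" by (auto simp: not_less simp del: ring_time.simps)
  then have "?P (Suc n)" by (simp only: PQ)
  moreover have "\<not> ?P 0" using assms(1) by (simp del: ring_time.simps(2) add: ring_time_Stream)
  ultimately have "(LEAST n. ?P n) = Suc (LEAST n. ?P (Suc n))"
    by (rule Least_Suc)
  then show ?thesis
    unfolding process_def by (simp only: PQ chain_Stream)
qed

lemma borel_measurable_exchange:
  fixes v :: "real \<Rightarrow> 'm::finite state \<Rightarrow> ennreal"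
  assumes "(\<lambda>p. v (fst p) (snd p)) \<in> borel_measurable (borel \<Otimes>\<^sub>M (borel :: 'm::finite state measure))"
  shows "(\<lambda>q. v (fst (fst q)) (exchange i (snd q) (snd (fst q))) :: ennreal)
    \<in> borel_measurable ((borel \<Otimes>\<^sub>M borel) \<Otimes>\<^sub>M unit_uniform)"
proof -
  let ?N = "((borel :: real measure) \<Otimes>\<^sub>M (borel :: 'm state measure)) \<Otimes>\<^sub>M unit_uniform"
  have "(\<lambda>q. (snd q, snd (fst q))) \<in> ?N \<rightarrow>\<^sub>M borel \<Otimes>\<^sub>M (borel :: 'm state measure)"
    by (intro measurable_Pair measurable_compose[OF measurable_snd] measurable_compose[OF measurable_fst])
      (auto simp: measurable_restrict_space1)
  from measurable_compose[OF this measurable_exchange[of i]]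
  have [measurable]: "(\<lambda>q. exchange i (snd q) (snd (fst q))) \<in> ?N \<rightarrow>\<^sub>M borel"
    by simp
  have "(\<lambda>q. (fst (fst q), exchange i (snd q) (snd (fst q)))) \<in> ?N \<rightarrow>\<^sub>M borel \<Otimes>\<^sub>M borel"
    by measurable
  from measurable_compose[OF this assms] show ?thesis by simp
qed

lemma exchange_kernel_measurable:
  fixes v :: "real \<Rightarrow> 'm::finite state \<Rightarrow> ennreal"
  assumes "(\<lambda>p. v (fst p) (snd p)) \<in> borel_measurable (borel \<Otimes>\<^sub>M borel)"
  shows "(\<lambda>p. v (t - fst p) (exchange i (snd p) (z :: 'm::finite state)) :: ennreal)
    \<in> borel_measurable (borel \<Otimes>\<^sub>M unit_uniform)"
proof -
  have "(\<lambda>p. ((t - fst p, z), snd p)) \<in> borel \<Otimes>\<^sub>M unit_uniform \<rightarrow>\<^sub>M (borel \<Otimes>\<^sub>M borel) \<Otimes>\<^sub>M unit_uniform"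
    by (intro measurable_Pair measurable_snd borel_measurable_diff borel_measurable_const measurable_fst)
  from measurable_compose[OF this borel_measurable_exchange[OF assms]] show ?thesis by simp
qed

text \<open>
  The generator without its loss term: each ring rate times the mean of \<open>v\<close> after that ring.
\<close>

definition gain :: "('m::finite state \<Rightarrow> ennreal) \<Rightarrow> 'm state \<Rightarrow> ennreal" where
  "gain v z = (\<Sum>i\<in>UNIV. ennreal (sqrt (fst z $ i)) * (\<integral>\<^sup>+u. v (exchange i u z) \<partial>unit_uniform))"

lemma borel_measurable_gain:
  fixes v :: "real \<Rightarrow> 'm::finite state \<Rightarrow> ennreal"
  assumes "(\<lambda>p. v (fst p) (snd p)) \<in> borel_measurable (borel \<Otimes>\<^sub>M (borel :: 'm::finite state measure))"
  shows "(\<lambda>p. gain (v (fst p)) (snd p)) \<in> borel_measurable (borel \<Otimes>\<^sub>M borel)"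
proof -
  have "(\<lambda>p. \<integral>\<^sup>+u. v (fst p) (exchange i u (snd p)) \<partial>unit_uniform) \<in> borel_measurable (borel \<Otimes>\<^sub>M borel)" for i
    using borel_measurable_exchange[OF assms, of i]
    by (intro unit_uniform.borel_measurable_nn_integral) (simp add: case_prod_beta')
  moreover have "(\<lambda>p. ennreal (sqrt (fst (snd p) $ i))) \<in> borel_measurable (borel \<Otimes>\<^sub>M (borel :: 'm state measure))" for i
    using measurable_compose[OF measurable_snd borel_measurable_fst_vec_nth[of i]] by measurable
  ultimately show ?thesis
    unfolding gain_def by (intro borel_measurable_sum borel_measurable_times_ennreal)
qed

lemma simplex_set_pos: "z \<in> simplex_set E \<Longrightarrow> 0 < fst z $ i"
  by (auto simp: simplex_set_def)

lemma sum_exponential_weights: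
  fixes z :: "'m::finite state" and c :: ennreal and f :: "real \<Rightarrow> ennreal"
  assumes pos: "\<And>i. 0 < fst z $ i" and [measurable]: "f \<in> borel_measurable borel"
  shows "(\<Sum>i\<in>UNIV. \<integral>\<^sup>+s. ennreal (sqrt (fst z $ i) * exp (- (total_rate z * s))) * c * f s \<partial>lborel)
    = c * (\<integral>\<^sup>+s. ennreal (total_rate z * exp (- (total_rate z * s))) * f s \<partial>lborel)"
proof -
  have "(\<Sum>i\<in>UNIV. \<integral>\<^sup>+s. ennreal (sqrt (fst z $ i) * exp (- (total_rate z * s))) * c * f s \<partial>lborel)
    = (\<integral>\<^sup>+s. (\<Sum>i\<in>UNIV. ennreal (sqrt (fst z $ i) * exp (- (total_rate z * s))) * c * f s) \<partial>lborel)"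
    by (rule nn_integral_sum[symmetric]) measurable
  also have "\<dots> = (\<integral>\<^sup>+s. c * (ennreal (total_rate z * exp (- (total_rate z * s))) * f s) \<partial>lborel)"
  proof (rule nn_integral_cong)
    fix s :: real
    have "(\<Sum>i\<in>UNIV. ennreal (sqrt (fst z $ i) * exp (- (total_rate z * s)))) = ennreal (total_rate z * exp (- (total_rate z * s)))"
      using less_imp_le[OF pos] by (subst sum_ennreal) (auto simp: total_rate_def sum_distrib_right)
    then show "(\<Sum>i\<in>UNIV. ennreal (sqrt (fst z $ i) * exp (- (total_rate z * s))) * c * f s)
      = c * (ennreal (total_rate z * exp (- (total_rate z * s))) * f s)"
      by (simp add: sum_distrib_right[symmetric] mult.assoc) (simp add: mult_ac)
  qed
  also have "\<dots> = c * (\<integral>\<^sup>+s. ennreal (total_rate z * exp (- (total_rate z * s))) * f s \<partial>lborel)"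
    by (intro nn_integral_cmult) measurable
  finally show ?thesis .
qed

lemma explosion_first_ring:
  assumes z: "z \<in> simplex_set E"
  shows "explosion t z = (\<Sum>i\<in>UNIV. \<integral>\<^sup>+s. ennreal (sqrt (fst z $ i) * exp (- (total_rate z * s)))
      * (\<integral>\<^sup>+u. (if s < t then explosion (t - s) (exchange i u z) else 0) \<partial>unit_uniform) * indicator {0<..} s \<partial>lborel)"
proof -
  define h where "h i s u = (if s < t then explosion (t - s) (exchange i u z) else 0)" for i s u
  have hm: "(\<lambda>p. h i (fst p) (snd p)) \<in> borel_measurable (borel \<Otimes>\<^sub>M unit_uniform)" for i
    unfolding h_def using exchange_kernel_measurable[OF measurable_explosion, of t i z] by measurable
  have ev: "(\<lambda>\<omega>. indicator {\<omega>. \<forall>n. ring_time z \<omega> (Suc n) < t} \<omega> :: ennreal) \<in> borel_measurable paths"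
    using measurable_compose[OF _ measurable_explosion_event, of "\<lambda>\<omega>. ((t, z), \<omega>)" paths] by simp
  have "explosion t z = (\<integral>\<^sup>+x. (\<integral>\<^sup>+\<omega>. indicator {\<omega>. \<forall>n. ring_time z \<omega> (Suc n) < t} (x ## \<omega>) \<partial>paths) \<partial>noise)"
    unfolding explosion_def by (rule noise.nn_integral_stream_space[OF ev])
  also have "\<dots> = (\<integral>\<^sup>+x. h (ringing z (fst x)) (waiting_time z (fst x)) (snd x) \<partial>noise)"
    by (intro nn_integral_cong) (simp add: h_def explosion_def indicator_def explosion_Stream del: ring_time.simps)
  also have "\<dots> = (\<Sum>i\<in>UNIV. \<integral>\<^sup>+s. ennreal (sqrt (fst z $ i) * exp (- (total_rate z * s)))
      * (\<integral>\<^sup>+u. h i s u \<partial>unit_uniform) * indicator {0<..} s \<partial>lborel)"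
    using simplex_set_pos[OF z] hm by (rule nn_integral_first_ring)
  finally show ?thesis by (simp only: h_def)
qed

text \<open>
  Let \<open>q\<close> be the supremum of the explosion probabilities over all states and all times up to \<open>t\<close>.
  An explosion needs a first ring before \<open>t\<close> and an explosion after it, so \<open>q \<le> c * q\<close>, where
  \<open>c < 1\<close> bounds the probability of a ring before \<open>t\<close>; hence \<open>q = 0\<close>.
\<close>

lemma explosion_zero:
  fixes z :: "'m::finite state"
  assumes z: "z \<in> simplex_set E"
  shows "explosion t z = 0"
proof -
  define R where "R = real CARD('m) * sqrt E"
  define I where "I = {..t} \<times> (simplex_set E :: 'm state set)"
  define q where "q = (SUP p\<in>I. explosion (fst p) (snd p))"
  define c where "c = (if 0 \<le> t then 1 - exp (- (R * t)) else 0)"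
  have R: "0 \<le> R" using total_rate_le[OF z] total_rate_pos[OF z] by (simp add: R_def)
  have c: "0 \<le> c" "c < 1" using R by (auto simp: c_def)
  have le1: "explosion s w \<le> 1" for s and w :: "'m state"
  proof -
    have "explosion s w \<le> (\<integral>\<^sup>+\<omega>. 1 \<partial>(paths :: 'm noise stream measure))"
      unfolding explosion_def by (intro nn_integral_mono) (auto split: split_indicator)
    then show ?thesis by (simp add: paths.emeasure_space_1)
  qed
  have "explosion s w \<le> ennreal c * q" if "s \<le> t" "w \<in> simplex_set E" for s and w :: "'m state"
  proof -
    have inner: "(\<integral>\<^sup>+u. (if r < s then explosion (s - r) (exchange i u w) else 0) \<partial>unit_uniform)
        \<le> q * indicator {..<s} r" if "0 < r" for r i
    proof -
      have "(\<integral>\<^sup>+u. (if r < s then explosion (s - r) (exchange i u w) else 0) \<partial>unit_uniform)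
        \<le> (\<integral>\<^sup>+u. q * indicator {..<s} r \<partial>unit_uniform)"
      proof (intro nn_integral_mono)
        fix u assume "u \<in> space unit_uniform"
        then have "(s - r, exchange i u w) \<in> I" 
          using \<open>0 < r\<close> \<open>s \<le> t\<close> \<open>w \<in> simplex_set E\<close> by (auto simp: I_def space_restrict_space intro: exchange_in_simplex)
        then have "explosion (s - r) (exchange i u w) \<le> q"
          unfolding q_def by (intro SUP_upper2[of "(s - r, exchange i u w)"]) auto
        then show "(if r < s then explosion (s - r) (exchange i u w) else 0) \<le> q * indicator {..<s} r"
          by auto
      qed
      then show ?thesis by (simp add: unit_uniform.emeasure_space_1 space_restrict_space)
    qed
    have "explosion s w \<le> (\<Sum>i\<in>UNIV. \<integral>\<^sup>+r. ennreal (sqrt (fst w $ i) * exp (- (total_rate w * r)))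
        * q * indicator {0<..<s} r \<partial>lborel)"
      unfolding explosion_first_ring[OF that(2)]
    proof (intro sum_mono nn_integral_mono)
      fix i and r :: real
      show "ennreal (sqrt (fst w $ i) * exp (- (total_rate w * r))) *
         (\<integral>\<^sup>+u. (if r < s then explosion (s - r) (exchange i u w) else 0) \<partial>unit_uniform) * indicator {0<..} r
        \<le> ennreal (sqrt (fst w $ i) * exp (- (total_rate w * r))) * q * indicator {0<..<s} r"
        using mult_left_mono[OF inner[of r i], of "ennreal (sqrt (fst w $ i) * exp (- (total_rate w * r)))"]
        by (auto split: split_indicator)
    qed
    also have "\<dots> = q * (\<integral>\<^sup>+r. ennreal (total_rate w * exp (- (total_rate w * r))) * indicator {0<..<s} r \<partial>lborel)"
      using simplex_set_pos[OF that(2)] by (intro sum_exponential_weights) auto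
    also have "(\<integral>\<^sup>+r. ennreal (total_rate w * exp (- (total_rate w * r))) * indicator {0<..<s} r \<partial>lborel) \<le> ennreal c"
    proof (cases "0 \<le> s")
      case True
      have "(\<integral>\<^sup>+r. ennreal (total_rate w * exp (- (total_rate w * r))) * indicator {0<..<s} r \<partial>lborel) = ennreal (1 - exp (- (total_rate w * s)))"
        using nn_integral_exponential_interval[of "total_rate w" 0 s] total_rate_pos[OF that(2)] True by simp
      also have "\<dots> \<le> ennreal c"
        using True that(1) total_rate_le[OF that(2)] total_rate_pos[OF that(2)]
        by (auto simp: c_def R_def intro!: ennreal_leI mult_mono)
      finally show ?thesis .
    qed (simp add: not_le)
    then have "q * (\<integral>\<^sup>+r. ennreal (total_rate w * exp (- (total_rate w * r))) * indicator {0<..<s} r \<partial>lborel) \<le> q * ennreal c"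
      by (rule mult_left_mono) simp
    finally show ?thesis by (simp add: mult.commute)
  qed
  then have "q \<le> ennreal c * q"
    unfolding q_def by (intro SUP_least) (auto simp: I_def q_def)
  moreover have "q \<le> 1" unfolding q_def by (intro SUP_least le1)
  then obtain x where x: "q = ennreal x" "0 \<le> x" by (cases q) (auto simp: top_unique)
  ultimately have "x \<le> c * x" using c by (simp add: ennreal_mult[symmetric])
  then have "x * (1 - c) \<le> 0" by (simp add: algebra_simps)
  then have "x = 0" using c x(2) by (simp add: mult_le_0_iff)
  moreover have "explosion t z \<le> q"
    unfolding q_def by (intro SUP_upper2[of "(t, z)"]) (auto simp: I_def z)
  ultimately show ?thesis by (simp add: x)
qed


section \<open>The backward equation\<close>

lemma nn_integral_exponential_tail:
  fixes c :: real assumes "0 < c"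
  shows "(\<integral>\<^sup>+s. ennreal (c * exp (- (c * s))) * indicator {t<..} s \<partial>lborel) = ennreal (exp (- (c * t)))"
proof -
  have "(\<integral>\<^sup>+s. ennreal (c * exp (- (c * s))) * indicator {t<..} s \<partial>lborel)
    = (\<integral>\<^sup>+s. ennreal (c * exp (- (c * (t + 1 * s)))) * indicator {t<..} (t + 1 * s) \<partial>lborel)"
    by (subst nn_integral_real_affine[where c = 1 and t = t]) auto
  also have "\<dots> = (\<integral>\<^sup>+s. ennreal (exp (- (c * t))) * (ennreal (c * exp (- (c * s))) * indicator {0<..} s) \<partial>lborel)"
  proof (rule nn_integral_cong)
    fix s
    have "exp (- (c * (t + 1 * s))) = exp (- (c * t)) * exp (- (c * s))"
      by (simp add: exp_add[symmetric] algebra_simps)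
    then show "ennreal (c * exp (- (c * (t + 1 * s)))) * indicator {t<..} (t + 1 * s)
      = ennreal (exp (- (c * t))) * (ennreal (c * exp (- (c * s))) * indicator {0<..} s)"
      using assms by (simp add: ennreal_mult[symmetric] mult.left_commute mult.assoc[symmetric] split: split_indicator)
  qed
  also have "\<dots> = ennreal (exp (- (c * t)))"
    using assms by (simp add: nn_integral_cmult nn_integral_exponential)
  finally show ?thesis .
qed

text \<open>
  After a ring at time \<open>s < t\<close> the path starts afresh from the new state with the time \<open>t - s\<close> left.
\<close>

lemma occupation_first_ring:
  assumes z: "z \<in> simplex_set E" and A[measurable]: "A \<in> sets (borel :: 'm::finite state measure)"
  shows "occupation A t z = (\<Sum>i\<in>UNIV. \<integral>\<^sup>+s. ennreal (sqrt (fst z $ i) * exp (- (total_rate z * s)))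
      * (\<integral>\<^sup>+u. (if s < t then occupation A (t - s) (exchange i u z) else indicator A z) \<partial>unit_uniform) * indicator {0<..} s \<partial>lborel)"
proof -
  define h where "h i s u = (if s < t then occupation A (t - s) (exchange i u z) else indicator A z)" for i s u
  have hm: "(\<lambda>p. h i (fst p) (snd p)) \<in> borel_measurable (borel \<Otimes>\<^sub>M unit_uniform)" for i
    unfolding h_def using exchange_kernel_measurable[OF measurable_occupation[OF A], of t i z] by measurable
  have pm: "(\<lambda>\<omega>. indicator A (process z t \<omega>) :: ennreal) \<in> borel_measurable paths"
    using measurable_compose[OF measurable_process_path borel_measurable_indicator[OF A]] .
  have "occupation A t z = (\<integral>\<^sup>+x. (\<integral>\<^sup>+\<omega>. indicator A (process z t (x ## \<omega>)) \<partial>paths) \<partial>noise)"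
    unfolding occupation_def by (rule noise.nn_integral_stream_space[OF pm])
  also have "\<dots> = (\<integral>\<^sup>+x. h (ringing z (fst x)) (waiting_time z (fst x)) (snd x) \<partial>noise)"
  proof (rule nn_integral_cong)
    fix x :: "'m noise" assume x: "x \<in> space noise"
    let ?w = "after_ring z x" and ?s = "waiting_time z (fst x)"
    show "(\<integral>\<^sup>+\<omega>. indicator A (process z t (x ## \<omega>)) \<partial>paths) = h (ringing z (fst x)) ?s (snd x)"
    proof (cases "?s < t")
      case True
      have "?w \<in> simplex_set E"
        using x z by (auto simp: noise_def space_pair_measure space_restrict_space intro: exchange_in_simplex)
      then have "explosion (t - ?s) ?w = 0" by (rule explosion_zero)
      moreover have "(\<lambda>\<omega>. indicator {\<omega>. \<forall>n. ring_time ?w \<omega> (Suc n) < t - ?s} \<omega> :: ennreal) \<in> borel_measurable paths"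
        using measurable_compose[OF _ measurable_explosion_event, of "\<lambda>\<omega>. ((t - ?s, ?w), \<omega>)" paths] by simp
      ultimately have "AE \<omega> in paths. indicator {\<omega>. \<forall>n. ring_time ?w \<omega> (Suc n) < t - ?s} \<omega> = (0::ennreal)"
        unfolding explosion_def by (subst (asm) nn_integral_0_iff_AE) auto
      then have "AE \<omega> in paths. process z t (x ## \<omega>) = process ?w (t - ?s) \<omega>"
      proof eventually_elim
        case (elim \<omega>)
        then have "\<not> (\<forall>n. ring_time ?w \<omega> (Suc n) < t - ?s)"
          by (auto simp: indicator_def simp del: ring_time.simps split: if_splits)
        then show ?case by (rule process_Stream_after[OF True])
      qed
      then have "(\<integral>\<^sup>+\<omega>. indicator A (process z t (x ## \<omega>)) \<partial>paths) = occupation A (t - ?s) ?w"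
        unfolding occupation_def by (intro nn_integral_cong_AE) auto
      then show ?thesis using True by (simp add: h_def)
    next
      case False
      then have "process z t (x ## \<omega>) = z" for \<omega>
        by (intro process_Stream_before) simp
      then show ?thesis using False by (simp add: h_def paths.emeasure_space_1)
    qed
  qed
  also have "\<dots> = (\<Sum>i\<in>UNIV. \<integral>\<^sup>+s. ennreal (sqrt (fst z $ i) * exp (- (total_rate z * s)))
      * (\<integral>\<^sup>+u. h i s u \<partial>unit_uniform) * indicator {0<..} s \<partial>lborel)"
    using simplex_set_pos[OF z] hm by (rule nn_integral_first_ring)
  finally show ?thesis by (simp only: h_def)
qed

text \<open>
  Either no ring occurs before \<open>t\<close>, or the first one leaves the remaining time \<open>r\<close>.
\<close>

lemma backward_equation:
  assumes z: "z \<in> simplex_set E" and A[measurable]: "A \<in> sets (borel :: 'm::finite state measure)"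
    and t: "0 < t"
  shows "occupation A t z = indicator A z * ennreal (exp (- (total_rate z * t)))
    + (\<integral>\<^sup>+r. ennreal (exp (- (total_rate z * (t - r)))) * gain (occupation A r) z * indicator {0<..<t} r \<partial>lborel)"
proof -
  define G where "G i s = (\<integral>\<^sup>+u. occupation A (t - s) (exchange i u z) \<partial>unit_uniform)" for i s
  have [measurable]: "G i \<in> borel_measurable borel" for i
    unfolding G_def using exchange_kernel_measurable[OF measurable_occupation[OF A], of t i z]
    by (intro unit_uniform.borel_measurable_nn_integral) (simp add: case_prod_beta')
  have gm[measurable]: "(\<lambda>r. gain (occupation A r) z) \<in> borel_measurable borel"
    using measurable_compose[OF _ borel_measurable_gain[OF measurable_occupation[OF A]], of "\<lambda>r. (r, z)" borel] by simp
  have "occupation A t z = (\<Sum>i\<in>UNIV. (\<integral>\<^sup>+s. ennreal (sqrt (fst z $ i) * exp (- (total_rate z * s))) * G i s * indicator {0<..<t} s \<partial>lborel)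
      + (\<integral>\<^sup>+s. ennreal (sqrt (fst z $ i) * exp (- (total_rate z * s))) * indicator A z * indicator {t<..} s \<partial>lborel))"
    unfolding occupation_first_ring[OF z A]
  proof (intro sum.cong refl)
    fix i
    have "(\<integral>\<^sup>+s. ennreal (sqrt (fst z $ i) * exp (- (total_rate z * s)))
      * (\<integral>\<^sup>+u. (if s < t then occupation A (t - s) (exchange i u z) else indicator A z) \<partial>unit_uniform) * indicator {0<..} s \<partial>lborel)
      = (\<integral>\<^sup>+s. ennreal (sqrt (fst z $ i) * exp (- (total_rate z * s))) * G i s * indicator {0<..<t} s
        + ennreal (sqrt (fst z $ i) * exp (- (total_rate z * s))) * indicator A z * indicator {t<..} s \<partial>lborel)"
      using t by (intro nn_integral_cong_AE, use AE_lborel_singleton[of t] in eventually_elim)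
        (auto simp: G_def space_restrict_space split: split_indicator)
    also have "\<dots> = (\<integral>\<^sup>+s. ennreal (sqrt (fst z $ i) * exp (- (total_rate z * s))) * G i s * indicator {0<..<t} s \<partial>lborel)
      + (\<integral>\<^sup>+s. ennreal (sqrt (fst z $ i) * exp (- (total_rate z * s))) * indicator A z * indicator {t<..} s \<partial>lborel)"
      by (rule nn_integral_add) measurable
    finally show "(\<integral>\<^sup>+s. ennreal (sqrt (fst z $ i) * exp (- (total_rate z * s)))
      * (\<integral>\<^sup>+u. (if s < t then occupation A (t - s) (exchange i u z) else indicator A z) \<partial>unit_uniform) * indicator {0<..} s \<partial>lborel)
      = \<dots>" .
  qed
  also have "\<dots> = (\<Sum>i\<in>UNIV. \<integral>\<^sup>+s. ennreal (sqrt (fst z $ i) * exp (- (total_rate z * s))) * G i s * indicator {0<..<t} s \<partial>lborel)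
      + indicator A z * ennreal (exp (- (total_rate z * t)))"
    using sum_exponential_weights[OF simplex_set_pos[OF z], of "indicator {t<..}" "indicator A z"]
      nn_integral_exponential_tail[OF total_rate_pos[OF z], of t]
    by (simp add: sum.distrib)
  also have "(\<Sum>i\<in>UNIV. \<integral>\<^sup>+s. ennreal (sqrt (fst z $ i) * exp (- (total_rate z * s))) * G i s * indicator {0<..<t} s \<partial>lborel)
    = (\<integral>\<^sup>+s. (\<Sum>i\<in>UNIV. ennreal (sqrt (fst z $ i) * exp (- (total_rate z * s))) * G i s * indicator {0<..<t} s) \<partial>lborel)"
    by (rule nn_integral_sum[symmetric]) measurable
  also have "\<dots> = (\<integral>\<^sup>+s. ennreal (exp (- (total_rate z * s))) * gain (occupation A (t - s)) z * indicator {0<..<t} s \<partial>lborel)"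
    by (intro nn_integral_cong)
      (auto simp: gain_def G_def sum_distrib_left ennreal_mult'' mult_ac intro!: sum.cong split: split_indicator)
  also have "\<dots> = (\<integral>\<^sup>+r. ennreal (exp (- (total_rate z * (t - r)))) * gain (occupation A r) z * indicator {0<..<t} r \<partial>lborel)"
  proof (subst nn_integral_real_affine[where c = "- 1" and t = t])
    show "(\<lambda>s. ennreal (exp (- (total_rate z * s))) * gain (occupation A (t - s)) z * indicator {0<..<t} s) \<in> borel_measurable borel"
      by measurable
  qed (auto intro!: nn_integral_cong split: split_indicator)
  finally show ?thesis by (simp add: add.commute)
qed

text \<open>
  The hypothesis is the variation of constants formula for \<open>v' = q - c * v\<close> with \<open>v 0 = b\<close>, and the
  conclusion is this equation integrated from \<open>0\<close> to \<open>t\<close>. Both sides are kept free of subtraction, so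
  that only Tonelli's theorem is needed and \<open>q\<close> may be any nonnegative measurable function.
\<close>

lemma integrated_linear_equation:
  fixes c :: real and b :: ennreal and q v :: "real \<Rightarrow> ennreal"
  assumes c: "0 < c" and q[measurable]: "q \<in> borel_measurable borel" and t: "0 < t"
    and v: "\<And>r. 0 < r \<Longrightarrow> v r = b * ennreal (exp (- (c * r)))
      + (\<integral>\<^sup>+s. ennreal (exp (- (c * (r - s)))) * q s * indicator {0<..<r} s \<partial>lborel)"
  shows "(\<integral>\<^sup>+r. ennreal c * v r * indicator {0<..<t} r \<partial>lborel) + v t
    = b + (\<integral>\<^sup>+s. q s * indicator {0<..<t} s \<partial>lborel)"
proof -
  \<comment> \<open>What enters at time \<open>a\<close> has either left by time \<open>t\<close> or is still there.\<close>
  have decay: "(\<integral>\<^sup>+r. ennreal (c * exp (- (c * (r - a)))) * indicator {a<..<t} r \<partial>lborel) + ennreal (exp (- (c * (t - a)))) = 1"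
    if "a \<le> t" for a
    using nn_integral_exponential_interval[of c a t] c that
    by (simp add: ennreal_plus[symmetric] del: ennreal_plus)
  have "(\<integral>\<^sup>+r. ennreal c * v r * indicator {0<..<t} r \<partial>lborel)
    = (\<integral>\<^sup>+r. b * (ennreal (c * exp (- (c * (r - 0)))) * indicator {0<..<t} r)
      + (\<integral>\<^sup>+s. q s * (ennreal (c * exp (- (c * (r - s)))) * indicator {0<..<r} s * indicator {0<..<t} r) \<partial>lborel) \<partial>lborel)"
  proof (rule nn_integral_cong)
    fix r
    show "ennreal c * v r * indicator {0<..<t} r = b * (ennreal (c * exp (- (c * (r - 0)))) * indicator {0<..<t} r)
      + (\<integral>\<^sup>+s. q s * (ennreal (c * exp (- (c * (r - s)))) * indicator {0<..<r} s * indicator {0<..<t} r) \<partial>lborel)"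
    proof (cases "r \<in> {0<..<t}")
      case True
      have "ennreal c * (\<integral>\<^sup>+s. ennreal (exp (- (c * (r - s)))) * q s * indicator {0<..<r} s \<partial>lborel)
        = (\<integral>\<^sup>+s. ennreal c * (ennreal (exp (- (c * (r - s)))) * q s * indicator {0<..<r} s) \<partial>lborel)"
        by (rule nn_integral_cmult[symmetric]) measurable
      also have "\<dots> = (\<integral>\<^sup>+s. q s * (ennreal (c * exp (- (c * (r - s)))) * indicator {0<..<r} s * indicator {0<..<t} r) \<partial>lborel)"
        using True by (intro nn_integral_cong) (simp add: ennreal_mult'' mult_ac)
      finally show ?thesis
        using True v[of r] by (simp add: distrib_left ennreal_mult'' mult_ac)
    qed simp
  qed
  also have "\<dots> = (\<integral>\<^sup>+r. b * (ennreal (c * exp (- (c * (r - 0)))) * indicator {0<..<t} r) \<partial>lborel)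
      + (\<integral>\<^sup>+r. (\<integral>\<^sup>+s. q s * (ennreal (c * exp (- (c * (r - s)))) * indicator {0<..<r} s * indicator {0<..<t} r) \<partial>lborel) \<partial>lborel)"
  proof (rule nn_integral_add)
    have "(\<lambda>p. q (snd p) * (ennreal (c * exp (- (c * (fst p - snd p)))) * indicator {p \<in> space (borel \<Otimes>\<^sub>M borel). 0 < snd p \<and> snd p < fst p} p * indicator {0<..<t} (fst p)))
      \<in> borel_measurable (borel \<Otimes>\<^sub>M lborel)"
      by measurable
    then have "(\<lambda>(r, s). q s * (ennreal (c * exp (- (c * (r - s)))) * indicator {0<..<r} s * indicator {0<..<t} r)) \<in> borel_measurable (borel \<Otimes>\<^sub>M lborel)"
      by (rule measurable_cong[THEN iffD1, rotated]) (auto simp: space_pair_measure split: split_indicator)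
    then show "(\<lambda>r. \<integral>\<^sup>+s. q s * (ennreal (c * exp (- (c * (r - s)))) * indicator {0<..<r} s * indicator {0<..<t} r) \<partial>lborel) \<in> borel_measurable lborel"
      by (intro lborel.borel_measurable_nn_integral[of _ lborel]) simp
  qed measurable
  also have "(\<integral>\<^sup>+r. (\<integral>\<^sup>+s. q s * (ennreal (c * exp (- (c * (r - s)))) * indicator {0<..<r} s * indicator {0<..<t} r) \<partial>lborel) \<partial>lborel)
    = (\<integral>\<^sup>+s. (\<integral>\<^sup>+r. q s * (ennreal (c * exp (- (c * (r - s)))) * indicator {0<..<r} s * indicator {0<..<t} r) \<partial>lborel) \<partial>lborel)"
  proof (rule lborel_pair.Fubini'[symmetric])
    have "(\<lambda>p. q (snd p) * (ennreal (c * exp (- (c * (fst p - snd p)))) * indicator {p \<in> space (borel \<Otimes>\<^sub>M borel). 0 < snd p \<and> snd p < fst p} p * indicator {0<..<t} (fst p)))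
      \<in> borel_measurable (lborel \<Otimes>\<^sub>M lborel)"
      by measurable
    then show "(\<lambda>(r, s). q s * (ennreal (c * exp (- (c * (r - s)))) * indicator {0<..<r} s * indicator {0<..<t} r)) \<in> borel_measurable (lborel \<Otimes>\<^sub>M lborel)"
      by (rule measurable_cong[THEN iffD1, rotated]) (auto simp: space_pair_measure split: split_indicator)
  qed
  also have "\<dots> = (\<integral>\<^sup>+s. q s * indicator {0<..<t} s * (\<integral>\<^sup>+r. ennreal (c * exp (- (c * (r - s)))) * indicator {s<..<t} r \<partial>lborel) \<partial>lborel)"
  proof (rule nn_integral_cong)
    fix s
    have "(\<integral>\<^sup>+r. q s * (ennreal (c * exp (- (c * (r - s)))) * indicator {0<..<r} s * indicator {0<..<t} r) \<partial>lborel)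
      = (\<integral>\<^sup>+r. (q s * indicator {0<..<t} s) * (ennreal (c * exp (- (c * (r - s)))) * indicator {s<..<t} r) \<partial>lborel)"
      by (intro nn_integral_cong) (auto split: split_indicator)
    also have "\<dots> = q s * indicator {0<..<t} s * (\<integral>\<^sup>+r. ennreal (c * exp (- (c * (r - s)))) * indicator {s<..<t} r \<partial>lborel)"
      by (rule nn_integral_cmult) measurable
    finally show "(\<integral>\<^sup>+r. q s * (ennreal (c * exp (- (c * (r - s)))) * indicator {0<..<r} s * indicator {0<..<t} r) \<partial>lborel)
      = q s * indicator {0<..<t} s * (\<integral>\<^sup>+r. ennreal (c * exp (- (c * (r - s)))) * indicator {s<..<t} r \<partial>lborel)" .
  qed
  finally have 1: "(\<integral>\<^sup>+r. ennreal c * v r * indicator {0<..<t} r \<partial>lborel)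
    = b * (\<integral>\<^sup>+r. ennreal (c * exp (- (c * (r - 0)))) * indicator {0<..<t} r \<partial>lborel)
      + (\<integral>\<^sup>+s. q s * indicator {0<..<t} s * (\<integral>\<^sup>+r. ennreal (c * exp (- (c * (r - s)))) * indicator {s<..<t} r \<partial>lborel) \<partial>lborel)"
    by (subst (asm) nn_integral_cmult) auto
  have 2: "(\<integral>\<^sup>+s. q s * indicator {0<..<t} s * (\<integral>\<^sup>+r. ennreal (c * exp (- (c * (r - s)))) * indicator {s<..<t} r \<partial>lborel) \<partial>lborel)
      + (\<integral>\<^sup>+s. ennreal (exp (- (c * (t - s)))) * q s * indicator {0<..<t} s \<partial>lborel)
    = (\<integral>\<^sup>+s. q s * indicator {0<..<t} s \<partial>lborel)"
  proof (subst nn_integral_add[symmetric])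
    have "(\<lambda>s. q s * indicator {0<..<t} s * ennreal (1 - exp (- (c * (t - s))))) \<in> borel_measurable lborel"
      by measurable
    moreover have "q s * indicator {0<..<t} s * ennreal (1 - exp (- (c * (t - s))))
      = q s * indicator {0<..<t} s * (\<integral>\<^sup>+r. ennreal (c * exp (- (c * (r - s)))) * indicator {s<..<t} r \<partial>lborel)" for s
      using nn_integral_exponential_interval[of c s t] c by (auto split: split_indicator)
    ultimately show "(\<lambda>s. q s * indicator {0<..<t} s * (\<integral>\<^sup>+r. ennreal (c * exp (- (c * (r - s)))) * indicator {s<..<t} r \<partial>lborel)) \<in> borel_measurable lborel"
      by simp
    show "(\<integral>\<^sup>+s. q s * indicator {0<..<t} s * (\<integral>\<^sup>+r. ennreal (c * exp (- (c * (r - s)))) * indicator {s<..<t} r \<partial>lborel)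
       + ennreal (exp (- (c * (t - s)))) * q s * indicator {0<..<t} s \<partial>lborel) = (\<integral>\<^sup>+s. q s * indicator {0<..<t} s \<partial>lborel)"
    proof (rule nn_integral_cong)
      fix s
      have "q s * indicator {0<..<t} s * (\<integral>\<^sup>+r. ennreal (c * exp (- (c * (r - s)))) * indicator {s<..<t} r \<partial>lborel)
          + ennreal (exp (- (c * (t - s)))) * q s * indicator {0<..<t} s
        = q s * indicator {0<..<t} s * ((\<integral>\<^sup>+r. ennreal (c * exp (- (c * (r - s)))) * indicator {s<..<t} r \<partial>lborel) + ennreal (exp (- (c * (t - s)))))"
        by (simp add: distrib_left mult_ac)
      then show "q s * indicator {0<..<t} s * (\<integral>\<^sup>+r. ennreal (c * exp (- (c * (r - s)))) * indicator {s<..<t} r \<partial>lborel)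
          + ennreal (exp (- (c * (t - s)))) * q s * indicator {0<..<t} s = q s * indicator {0<..<t} s"
        using decay[of s] by (auto split: split_indicator)
    qed
  qed measurable
  have "b * (\<integral>\<^sup>+r. ennreal (c * exp (- (c * (r - 0)))) * indicator {0<..<t} r \<partial>lborel) + b * ennreal (exp (- (c * t))) = b"
    using decay[of 0] t by (simp add: distrib_left[symmetric])
  moreover have "(\<alpha> + \<beta>) + (\<gamma> + \<delta>) = \<sigma> + \<tau>" if "\<alpha> + \<gamma> = \<sigma>" "\<beta> + \<delta> = \<tau>" for \<alpha> \<beta> \<gamma> \<delta> \<sigma> \<tau> :: ennreal
    using that by (auto simp: ac_simps)
  ultimately show ?thesis
    unfolding 1 v[OF t] using 2 by blast
qed

lemma integrated_backward_equation:
  assumes z: "z \<in> simplex_set E" and A[measurable]: "A \<in> sets (borel :: 'm::finite state measure)"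
    and t: "0 < t"
  shows "(\<integral>\<^sup>+r. ennreal (total_rate z) * occupation A r z * indicator {0<..<t} r \<partial>lborel) + occupation A t z
    = indicator A z + (\<integral>\<^sup>+r. gain (occupation A r) z * indicator {0<..<t} r \<partial>lborel)"
proof (rule integrated_linear_equation[OF total_rate_pos[OF z] _ t])
  show "(\<lambda>r. gain (occupation A r) z) \<in> borel_measurable borel"
    using measurable_compose[OF _ borel_measurable_gain[OF measurable_occupation[OF A]], of "\<lambda>r. (r, z)" borel] by simp
qed (rule backward_equation[OF z A])

section \<open>Coordinates on the simplex\<close>

text \<open>
  Functions on the index type replace vectors here, because the product measure on them allows single
  coordinates to be integrated out.
\<close>

abbreviation coord_lebesgue :: "('m::finite \<Rightarrow> real) measure" where
  "coord_lebesgue \<equiv> \<Pi>\<^sub>M i\<in>UNIV. lborel"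

interpretation coord_lebesgue: product_sigma_finite "\<lambda>_::'m::finite. lborel :: real measure"
  by standard

definition coord_simplex :: "real \<Rightarrow> ('m::finite \<Rightarrow> real) set" where
  "coord_simplex E = {f. (\<forall>i. 0 < f i) \<and> sum f UNIV < E}"

definition state_of :: "real \<Rightarrow> ('m::finite \<Rightarrow> real) \<Rightarrow> 'm state" where
  "state_of E f = chart E (vec_lambda f)"

text \<open>
  The energy of particle \<open>i\<close> and the tank together, written in terms of the coordinates that a ring
  of \<open>i\<close> leaves unchanged.
\<close>

definition pair_energy :: "real \<Rightarrow> 'm::finite \<Rightarrow> ('m \<Rightarrow> real) \<Rightarrow> real" where
  "pair_energy E i f = E - sum f (UNIV - {i})"

lemma fst_state_of[simp]: "fst (state_of E f) $ i = f i"
  by (simp add: state_of_def chart_def)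

lemma snd_state_of[simp]: "snd (state_of E f) = E - sum f UNIV"
  by (simp add: state_of_def chart_def)

lemma state_of_in_simplex[simp]: "state_of E f \<in> simplex_set E \<longleftrightarrow> f \<in> coord_simplex E"
  by (auto simp: state_of_def chart_def simplex_set_def coord_simplex_def)

lemma simplex_setE:
  assumes "z \<in> simplex_set E"
  obtains f where "f \<in> coord_simplex E" "z = state_of E f"
proof
  show "z = state_of E (vec_nth (fst z))"
    using assms by (auto simp: state_of_def chart_def simplex_set_def)
  then show "vec_nth (fst z) \<in> coord_simplex E"
    using assms by (metis state_of_in_simplex)
qed

lemma sum_pair_energy: "sum f UNIV = f i + (E - pair_energy E i f)"
  by (simp add: pair_energy_def sum.remove[of UNIV i f])

lemma pair_energy_upd[simp]: "pair_energy E i (f(i := t)) = pair_energy E i f"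
proof -
  have "sum (f(i := t)) (UNIV - {i}) = sum f (UNIV - {i})"
    by (rule sum.cong) auto
  then show ?thesis by (simp only: pair_energy_def)
qed

lemma coord_simplex_upd:
  "f(i := t) \<in> coord_simplex E \<longleftrightarrow> (\<forall>j. j \<noteq> i \<longrightarrow> 0 < f j) \<and> 0 < t \<and> t < pair_energy E i f"
  unfolding coord_simplex_def by (subst mem_Collect_eq, subst sum_pair_energy[of _ i E]) auto

lemma exchange_state_of:
  "exchange i u (state_of E f) = state_of E (f(i := pair_energy E i f - u\<^sup>2 * f i))"
proof -
  have "E - sum (f(i := pair_energy E i f - u\<^sup>2 * f i)) UNIV = u\<^sup>2 * f i"
    by (subst sum_pair_energy[of _ i E]) simp
  moreover have "E - sum f UNIV + (1 - u\<^sup>2) * f i = pair_energy E i f - u\<^sup>2 * f i"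
    by (subst sum_pair_energy[of _ i E]) (simp add: algebra_simps)
  ultimately show ?thesis
    by (intro prod_eqI) (auto simp: exchange_def vec_eq_iff)
qed

lemma total_rate_state_of: "total_rate (state_of E f) = (\<Sum>i\<in>UNIV. sqrt (f i))"
  by (simp add: total_rate_def)

lemma measurable_component_lebesgue: "(\<lambda>f. f i) \<in> borel_measurable (coord_lebesgue :: ('m::finite \<Rightarrow> real) measure)"
  by (rule measurable_compose[OF measurable_component_singleton]) auto

lemma measurable_vec_lambda: "vec_lambda \<in> coord_lebesgue \<rightarrow>\<^sub>M (borel :: (real ^ 'm::finite) measure)"
  by (subst borel_measurable_euclidean_space)
    (auto simp: Basis_vec_def inner_axis intro: measurable_component_lebesgue)

lemma lborel_eq_distr_vec_lambda:
  "(lborel :: (real ^ 'm::finite) measure) = distr coord_lebesgue borel vec_lambda"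
proof (rule lborel_eqI)
  fix l u :: "real ^ 'm" assume le: "\<And>b. b \<in> Basis \<Longrightarrow> l \<bullet> b \<le> u \<bullet> b"
  have le': "l $ i \<le> u $ i" for i
    using le[of "axis i 1"] by (simp add: inner_axis axis_in_Basis_iff)
  have "emeasure (distr coord_lebesgue borel vec_lambda) (box l u)
    = emeasure (coord_lebesgue :: ('m \<Rightarrow> real) measure) (\<Pi>\<^sub>E i\<in>UNIV. {l $ i<..<u $ i})"
    by (subst emeasure_distr[OF measurable_vec_lambda])
      (auto simp: mem_box_cart space_PiM PiE_iff intro!: arg_cong2[where f = emeasure])
  also have "\<dots> = (\<Prod>i\<in>UNIV. ennreal (u $ i - l $ i))"
    using le' by (subst coord_lebesgue.emeasure_PiM) auto
  also have "\<dots> = ennreal (\<Prod>i\<in>UNIV. (u - l) $ i)"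
    using le' by (subst prod_ennreal) auto
  also have "(\<Prod>i\<in>UNIV. (u - l) $ i) = (\<Prod>b\<in>(\<lambda>i. axis i 1) ` UNIV. (u - l) \<bullet> b)"
    by (subst prod.reindex) (auto simp: inj_on_def axis_eq_axis inner_axis)
  also have "(\<lambda>i. axis i (1::real)) ` UNIV = (Basis :: (real ^ 'm) set)"
    by (auto simp: Basis_vec_def)
  finally show "emeasure (distr coord_lebesgue borel vec_lambda) (box l u) = ennreal (\<Prod>b\<in>Basis. (u - l) \<bullet> b)" .
qed simp

lemma measurable_chart: "chart E \<in> borel \<rightarrow>\<^sub>M (borel :: 'm::finite state measure)"
  unfolding chart_def by (intro borel_measurable_continuous_onI continuous_intros)

lemma measurable_state_of: "state_of E \<in> coord_lebesgue \<rightarrow>\<^sub>M (borel :: 'm::finite state measure)"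
  unfolding state_of_def using measurable_compose[OF measurable_vec_lambda measurable_chart] .

lemma coord_simplex_measurable: "coord_simplex E \<in> sets (coord_lebesgue :: ('m::finite \<Rightarrow> real) measure)"
proof -
  have "state_of E -` (simplex_set E :: 'm state set) \<inter> space coord_lebesgue \<in> sets coord_lebesgue"
    by (rule measurable_sets[OF measurable_state_of simplex_set_borel])
  then show ?thesis by (simp add: vimage_def space_PiM)
qed

lemma nn_integral_simplex_lebesgue:
  assumes g: "g \<in> borel_measurable (simplex_space E :: 'm::finite state measure)"
  shows "(\<integral>\<^sup>+z. g z \<partial>simplex_lebesgue E)
    = (\<integral>\<^sup>+f. g (state_of E f) * indicator (coord_simplex E) f \<partial>coord_lebesgue)"
proof -
  let ?D = "{x. chart E x \<in> (simplex_set E :: 'm state set)}"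
  have D: "?D \<in> sets borel"
    using measurable_sets[OF measurable_chart simplex_set_borel, of E E] by (simp add: vimage_def)
  have c: "chart E \<in> restrict_space lborel ?D \<rightarrow>\<^sub>M simplex_space E"
    unfolding simplex_space_def
    by (intro measurable_restrict_space2 measurable_restrict_space1) (auto simp: space_restrict_space measurable_chart)
  have "(\<lambda>x. g (chart E x) * indicator ?D x) \<in> borel_measurable borel"
  proof -
    have "(\<lambda>z. g z * indicator (simplex_set E) z) \<in> borel_measurable borel"
      using g unfolding simplex_space_def
      by (subst (asm) borel_measurable_restrict_space_iff_ennreal) auto
    from measurable_compose[OF measurable_chart this] show ?thesis
      by (rule measurable_cong[THEN iffD1, rotated]) (auto split: split_indicator)
  qed
  note m = this
  have "(\<integral>\<^sup>+z. g z \<partial>simplex_lebesgue E) = (\<integral>\<^sup>+x. g (chart E x) \<partial>restrict_space lborel ?D)"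
    unfolding simplex_lebesgue_def by (rule nn_integral_distr[OF c]) (use g in simp)
  also have "\<dots> = (\<integral>\<^sup>+x. g (chart E x) * indicator ?D x \<partial>lborel)"
    using D by (intro nn_integral_restrict_space) simp
  also have "\<dots> = (\<integral>\<^sup>+f. g (chart E (vec_lambda f)) * indicator ?D (vec_lambda f) \<partial>coord_lebesgue)"
    unfolding lborel_eq_distr_vec_lambda using m by (intro nn_integral_distr measurable_vec_lambda) simp
  also have "\<dots> = (\<integral>\<^sup>+f. g (state_of E f) * indicator (coord_simplex E) f \<partial>coord_lebesgue)"
    by (intro nn_integral_cong) (auto simp: state_of_def[symmetric] split: split_indicator)
  finally show ?thesis .
qed

section \<open>Stationarity of the equilibrium\<close>

text \<open>
  The substitution \<open>t = S - u\<^sup>2 * a\<close>, in which \<open>a\<close> is the energy of the ringing particle and \<open>S\<close> its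
  pair energy; the rate \<open>sqrt a\<close> cancels.
\<close>

lemma nn_integral_exchanged_energy:
  fixes F :: "real \<Rightarrow> ennreal"
  assumes a: "0 < a" and F[measurable]: "F \<in> borel_measurable borel"
  shows "ennreal (sqrt a) * (\<integral>\<^sup>+u. F (S - u\<^sup>2 * a) \<partial>unit_uniform)
    = (\<integral>\<^sup>+t. F t * ennreal (1 / (2 * sqrt (S - t))) * indicator {S - a<..<S} t \<partial>lborel)"
proof -
  have "(\<integral>\<^sup>+t. F t * ennreal (1 / (2 * sqrt (S - t))) * indicator {S - a<..<S} t \<partial>lborel)
    = (\<integral>\<^sup>+v. F (S - v) * ennreal (1 / (2 * sqrt v)) * indicator {0<..<a} v \<partial>lborel)"
    by (subst nn_integral_real_affine[where c = "- 1" and t = S]) (auto intro!: nn_integral_cong split: split_indicator)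
  also have "\<dots> = (\<integral>\<^sup>+v. F (S - v) * ennreal (1 / (2 * sqrt v)) * indicator {a * 0\<^sup>2..a * 1\<^sup>2} v \<partial>lborel)"
    using a by (intro nn_integral_cong_AE, use AE_lborel_singleton[of 0] AE_lborel_singleton[of a] in eventually_elim)
      (auto split: split_indicator)
  also have "\<dots> = (\<integral>\<^sup>+u. F (S - a * u\<^sup>2) * ennreal (1 / (2 * sqrt (a * u\<^sup>2))) * ennreal (a * (2 * u)) * indicator {0..1} u \<partial>lborel)"
    using a by (intro nn_integral_substitution_aux[where g = "\<lambda>u. a * u\<^sup>2" and a = 0 and b = 1])
      (auto intro!: derivative_eq_intros continuous_intros)
  also have "\<dots> = (\<integral>\<^sup>+u. ennreal (sqrt a) * (F (S - u\<^sup>2 * a) * indicator {0<..<1} u) \<partial>lborel)"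
  proof (intro nn_integral_cong_AE, use AE_lborel_singleton[of 0] AE_lborel_singleton[of 1] in eventually_elim)
    fix u :: real assume "u \<noteq> 0" "u \<noteq> 1"
    have "1 / (2 * sqrt (a * u\<^sup>2)) * (a * (2 * u)) = sqrt a" if "0 < u"
      using a that by (simp add: real_sqrt_mult real_div_sqrt)
    then have *: "ennreal (1 / (2 * sqrt (a * u\<^sup>2))) * ennreal (a * (2 * u)) = ennreal (sqrt a)" if "0 < u"
      using a that by (subst ennreal_mult[symmetric]) auto
    have "F (S - a * u\<^sup>2) * ennreal (1 / (2 * sqrt (a * u\<^sup>2))) * ennreal (a * (2 * u)) = F (S - a * u\<^sup>2) * ennreal (sqrt a)"
      if "0 < u"
      by (simp only: mult.assoc *[OF that])
    then show "F (S - a * u\<^sup>2) * ennreal (1 / (2 * sqrt (a * u\<^sup>2))) * ennreal (a * (2 * u)) * indicator {0..1} u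
      = ennreal (sqrt a) * (F (S - u\<^sup>2 * a) * indicator {0<..<1} u)"
      using \<open>u \<noteq> 0\<close> \<open>u \<noteq> 1\<close> by (cases "0 < u \<and> u < 1") (auto simp: mult.commute[of "ennreal (sqrt a)"] mult.commute[of a] split: split_indicator)
  qed
  also have "\<dots> = ennreal (sqrt a) * (\<integral>\<^sup>+u. F (S - u\<^sup>2 * a) * indicator {0<..<1} u \<partial>lborel)"
    by (rule nn_integral_cmult) measurable
  also have "(\<integral>\<^sup>+u. F (S - u\<^sup>2 * a) * indicator {0<..<1} u \<partial>lborel) = (\<integral>\<^sup>+u. F (S - u\<^sup>2 * a) \<partial>unit_uniform)"
    by (simp add: nn_integral_restrict_space)
  finally show ?thesis by simp
qed

text \<open>
  The primitive of the inverse square root comes for free as the total mass of the preceding law.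
\<close>

lemma nn_integral_inverse_sqrt:
  assumes "0 < a"
  shows "(\<integral>\<^sup>+t. ennreal (1 / (2 * sqrt (S - t))) * indicator {S - a<..<S} t \<partial>lborel) = ennreal (sqrt a)"
  using nn_integral_exchanged_energy[OF assms, of "\<lambda>_. 1" S] by (simp add: space_restrict_space)

lemma gain_state_of:
  assumes f: "f \<in> coord_simplex E" and v[measurable]: "v \<in> borel_measurable (borel :: 'm::finite state measure)"
  shows "gain v (state_of E f) = (\<Sum>i\<in>UNIV. \<integral>\<^sup>+t. v (state_of E (f(i := t)))
      * ennreal (1 / (2 * sqrt (pair_energy E i f - t))) * indicator {pair_energy E i f - f i<..<pair_energy E i f} t \<partial>lborel)"
  unfolding gain_def
proof (intro sum.cong refl)
  fix i
  have "(\<lambda>t. f(i := t)) \<in> borel \<rightarrow>\<^sub>M (coord_lebesgue :: ('m \<Rightarrow> real) measure)"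
    by (rule measurable_fun_upd[where J = UNIV]) (auto simp: space_PiM)
  from measurable_compose[OF measurable_compose[OF this measurable_state_of] v]
  have "(\<lambda>t. v (state_of E (f(i := t)))) \<in> borel_measurable borel" .
  moreover have "0 < f i" using f by (auto simp: coord_simplex_def)
  ultimately show "ennreal (sqrt (fst (state_of E f) $ i)) * (\<integral>\<^sup>+u. v (exchange i u (state_of E f)) \<partial>unit_uniform)
    = (\<integral>\<^sup>+t. v (state_of E (f(i := t))) * ennreal (1 / (2 * sqrt (pair_energy E i f - t)))
        * indicator {pair_energy E i f - f i<..<pair_energy E i f} t \<partial>lborel)"
    by (subst nn_integral_exchanged_energy[symmetric]) (auto simp: exchange_state_of)
qed

text \<open>
  Stationarity of the density \<open>1 / sqrt (S - x)\<close> under the rings of one particle, tested against \<open>G\<close>.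
  By Fubini's theorem, the weight that \<open>t\<close> receives on the right is \<open>1 / (2 * sqrt (S - t))\<close> times the
  integral of \<open>1 / sqrt (S - x)\<close> over \<open>S - t < x < S\<close>, which is \<open>2 * sqrt t\<close>.
\<close>

lemma balance_on_line:
  fixes G :: "real \<Rightarrow> ennreal"
  assumes G[measurable]: "G \<in> borel_measurable borel"
  shows "(\<integral>\<^sup>+x. indicator {0<..<S} x * ennreal (1 / sqrt (S - x)) * (ennreal (sqrt x) * G x) \<partial>lborel)
    = (\<integral>\<^sup>+x. indicator {0<..<S} x * ennreal (1 / sqrt (S - x))
        * (\<integral>\<^sup>+t. G t * ennreal (1 / (2 * sqrt (S - t))) * indicator {S - x<..<S} t \<partial>lborel) \<partial>lborel)"
proof -
  define K where "K x t = indicator {0<..<S} t * G t * ennreal (1 / (2 * sqrt (S - t)))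
    * (ennreal 2 * ennreal (1 / (2 * sqrt (S - x))) * indicator {S - t<..<S} x)" for x t
  have "(\<lambda>p. indicator {0<..<S} (snd p) * G (snd p) * ennreal (1 / (2 * sqrt (S - snd p)))
      * (ennreal 2 * ennreal (1 / (2 * sqrt (S - fst p))) * indicator {p \<in> space (borel \<Otimes>\<^sub>M borel). S - snd p < fst p \<and> fst p < S} p))
    \<in> borel_measurable (lborel \<Otimes>\<^sub>M lborel)"
    by measurable
  then have K: "case_prod K \<in> borel_measurable (lborel \<Otimes>\<^sub>M lborel)"
    by (rule measurable_cong[THEN iffD1, rotated]) (auto simp: K_def space_pair_measure split: split_indicator)
  have "(\<integral>\<^sup>+x. indicator {0<..<S} x * ennreal (1 / sqrt (S - x))
        * (\<integral>\<^sup>+t. G t * ennreal (1 / (2 * sqrt (S - t))) * indicator {S - x<..<S} t \<partial>lborel) \<partial>lborel)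
    = (\<integral>\<^sup>+x. (\<integral>\<^sup>+t. K x t \<partial>lborel) \<partial>lborel)"
  proof (rule nn_integral_cong)
    fix x
    have "(\<integral>\<^sup>+t. indicator {0<..<S} x * ennreal (1 / sqrt (S - x)) * (G t * ennreal (1 / (2 * sqrt (S - t))) * indicator {S - x<..<S} t) \<partial>lborel)
      = (\<integral>\<^sup>+t. K x t \<partial>lborel)"
    proof (rule nn_integral_cong)
      fix t
      have "ennreal (1 / sqrt (S - x)) = ennreal 2 * ennreal (1 / (2 * sqrt (S - x)))" if "x < S"
        using that by (subst ennreal_mult[symmetric]) auto
      then show "indicator {0<..<S} x * ennreal (1 / sqrt (S - x)) * (G t * ennreal (1 / (2 * sqrt (S - t))) * indicator {S - x<..<S} t) = K x t"
        by (auto simp: K_def mult_ac split: split_indicator)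
    qed
    then show "indicator {0<..<S} x * ennreal (1 / sqrt (S - x))
        * (\<integral>\<^sup>+t. G t * ennreal (1 / (2 * sqrt (S - t))) * indicator {S - x<..<S} t \<partial>lborel) = (\<integral>\<^sup>+t. K x t \<partial>lborel)"
      by (subst (asm) nn_integral_cmult) auto
  qed
  also have "\<dots> = (\<integral>\<^sup>+t. (\<integral>\<^sup>+x. K x t \<partial>lborel) \<partial>lborel)"
    by (rule lborel_pair.Fubini'[symmetric, OF K])
  also have "\<dots> = (\<integral>\<^sup>+x. indicator {0<..<S} x * ennreal (1 / sqrt (S - x)) * (ennreal (sqrt x) * G x) \<partial>lborel)"
  proof (rule nn_integral_cong)
    fix t
    show "(\<integral>\<^sup>+x. K x t \<partial>lborel) = indicator {0<..<S} t * ennreal (1 / sqrt (S - t)) * (ennreal (sqrt t) * G t)"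
    proof (cases "t \<in> {0<..<S}")
      case True
      have "(\<integral>\<^sup>+x. K x t \<partial>lborel) = G t * ennreal (1 / (2 * sqrt (S - t))) * ennreal 2 * ennreal (sqrt t)"
        unfolding K_def using True
        by (simp add: nn_integral_cmult nn_integral_inverse_sqrt mult.assoc)
      also have "\<dots> = G t * (ennreal (1 / (2 * sqrt (S - t))) * ennreal 2) * ennreal (sqrt t)"
        by (simp only: mult.assoc)
      also have "ennreal (1 / (2 * sqrt (S - t))) * ennreal 2 = ennreal (1 / sqrt (S - t))"
        using True by (subst ennreal_mult[symmetric]) auto
      finally show ?thesis using True by (simp add: mult_ac)
    qed (simp add: K_def)
  qed
  finally show ?thesis by simp
qed

text \<open>
  The equilibrium density before normalization, in coordinates.
\<close>

definition weight :: "real \<Rightarrow> ('m::finite \<Rightarrow> real) \<Rightarrow> ennreal" where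
  "weight E f = indicator (coord_simplex E) f * ennreal (1 / sqrt (E - sum f UNIV))"

lemma measurable_sum_coords: "(\<lambda>f. sum f UNIV) \<in> borel_measurable (coord_lebesgue :: ('m::finite \<Rightarrow> real) measure)"
  by (intro borel_measurable_sum measurable_component_lebesgue)

lemma measurable_weight: "weight E \<in> borel_measurable (coord_lebesgue :: ('m::finite \<Rightarrow> real) measure)"
  unfolding weight_def using measurable_sum_coords coord_simplex_measurable by measurable

lemma weight_upd:
  "weight E (f(i := t)) = (if \<forall>j. j \<noteq> i \<longrightarrow> 0 < f j then
      indicator {0<..<pair_energy E i f} t * ennreal (1 / sqrt (pair_energy E i f - t)) else 0)"
proof -
  have "E - sum (f(i := t)) UNIV = pair_energy E i f - t"
    by (subst sum_pair_energy[of _ i E]) simp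
  then show ?thesis
    by (auto simp: weight_def coord_simplex_upd simp del: fun_upd_apply split: split_indicator)
qed

lemma nn_integral_coordinate:
  assumes "H \<in> borel_measurable (coord_lebesgue :: ('m::finite \<Rightarrow> real) measure)"
  shows "(\<integral>\<^sup>+f. H f \<partial>coord_lebesgue) = (\<integral>\<^sup>+f. (\<integral>\<^sup>+x. H (f(i := x)) \<partial>lborel) \<partial>Pi\<^sub>M (UNIV - {i}) (\<lambda>_. lborel))"
proof -
  have U: "insert i (UNIV - {i}) = UNIV" by auto
  show ?thesis
    using coord_lebesgue.product_nn_integral_insert[of "UNIV - {i}" i H] assms by (simp add: U)
qed

lemma borel_measurable_line_average:
  assumes G: "G \<in> borel_measurable (coord_lebesgue :: ('m::finite \<Rightarrow> real) measure)"
  shows "(\<lambda>f. \<integral>\<^sup>+t. G (f(i := t)) * ennreal (1 / (2 * sqrt (pair_energy E i f - t)))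
      * indicator {pair_energy E i f - f i<..<pair_energy E i f} t \<partial>lborel) \<in> borel_measurable coord_lebesgue"
proof -
  have pe: "(\<lambda>f. pair_energy E i f) \<in> borel_measurable (coord_lebesgue :: ('m \<Rightarrow> real) measure)"
    unfolding pair_energy_def by (intro borel_measurable_diff borel_measurable_const borel_measurable_sum measurable_component_lebesgue)
  let ?N = "(coord_lebesgue :: ('m \<Rightarrow> real) measure) \<Otimes>\<^sub>M (lborel :: real measure)"
  have [measurable]: "(\<lambda>p. pair_energy E i (fst p)) \<in> borel_measurable ?N" "(\<lambda>p. fst p i) \<in> borel_measurable ?N"
    using measurable_compose[OF measurable_fst pe] measurable_compose[OF measurable_fst measurable_component_lebesgue] by auto
  have "(\<lambda>p. (fst p)(i := snd p)) \<in> ?N \<rightarrow>\<^sub>M coord_lebesgue"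
    by (rule measurable_fun_upd[where J = UNIV]) auto
  from measurable_compose[OF this G] have [measurable]: "(\<lambda>p. G ((fst p)(i := snd p))) \<in> borel_measurable ?N" .
  have "(\<lambda>p. G ((fst p)(i := snd p)) * ennreal (1 / (2 * sqrt (pair_energy E i (fst p) - snd p)))
      * indicator {p \<in> space ?N. pair_energy E i (fst p) - fst p i < snd p \<and> snd p < pair_energy E i (fst p)} p) \<in> borel_measurable ?N"
    by measurable
  then have "(\<lambda>(f, t). G (f(i := t)) * ennreal (1 / (2 * sqrt (pair_energy E i f - t)))
      * indicator {pair_energy E i f - f i<..<pair_energy E i f} t) \<in> borel_measurable ?N"
    by (rule measurable_cong[THEN iffD1, rotated]) (auto simp: space_pair_measure split: split_indicator)
  then show "(\<lambda>f. \<integral>\<^sup>+t. G (f(i := t)) * ennreal (1 / (2 * sqrt (pair_energy E i f - t)))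
      * indicator {pair_energy E i f - f i<..<pair_energy E i f} t \<partial>lborel) \<in> borel_measurable coord_lebesgue"
    by (rule lborel.borel_measurable_nn_integral)
qed

text \<open>
  Fubini's theorem reduces this to \<open>balance_on_line\<close> on each line on which only the energies of particle
  \<open>i\<close> and of the tank vary, with \<open>S\<close> the pair energy of that line.
\<close>

lemma balance:
  assumes G[measurable]: "G \<in> borel_measurable (coord_lebesgue :: ('m::finite \<Rightarrow> real) measure)"
  shows "(\<integral>\<^sup>+f. weight E f * (ennreal (sqrt (f i)) * G f) \<partial>coord_lebesgue)
    = (\<integral>\<^sup>+f. weight E f * (\<integral>\<^sup>+t. G (f(i := t)) * ennreal (1 / (2 * sqrt (pair_energy E i f - t)))
        * indicator {pair_energy E i f - f i<..<pair_energy E i f} t \<partial>lborel) \<partial>coord_lebesgue)"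
    (is "(\<integral>\<^sup>+f. ?L f \<partial>_) = (\<integral>\<^sup>+f. ?R f \<partial>_)")
proof -
  have L: "?L \<in> borel_measurable coord_lebesgue"
    using measurable_weight measurable_component_lebesgue[of i] by measurable
  have R: "?R \<in> borel_measurable coord_lebesgue"
    using measurable_weight borel_measurable_line_average[OF G, of i E] by measurable
  show ?thesis
    unfolding nn_integral_coordinate[OF L, of i] nn_integral_coordinate[OF R, of i]
  proof (rule nn_integral_cong)
    fix f :: "'m \<Rightarrow> real"
    have "(\<lambda>t. f(i := t)) \<in> borel \<rightarrow>\<^sub>M (coord_lebesgue :: ('m \<Rightarrow> real) measure)"
      by (rule measurable_fun_upd[where J = UNIV]) (auto simp: space_PiM)
    from measurable_compose[OF this G] have G': "(\<lambda>t. G (f(i := t))) \<in> borel_measurable borel" .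
    show "(\<integral>\<^sup>+x. ?L (f(i := x)) \<partial>lborel) = (\<integral>\<^sup>+x. ?R (f(i := x)) \<partial>lborel)"
    proof (cases "\<forall>j. j \<noteq> i \<longrightarrow> 0 < f j")
      case True
      note w = weight_upd[of E f i, unfolded if_P[OF True]]
      show ?thesis
        using balance_on_line[OF G', of "pair_energy E i f"]
        by (simp only: w pair_energy_upd fun_upd_upd fun_upd_same)
    next
      case False
      note w = weight_upd[of E f i, unfolded if_not_P[OF False]]
      show ?thesis by (simp only: w mult_zero_left)
    qed
  qed
qed

text \<open>
  Integrating out a single coordinate leaves \<open>2 * sqrt S \<le> 2 * sqrt E\<close>, and the remaining coordinates
  range over a bounded set.
\<close>

lemma weight_mass_finite:
  "(\<integral>\<^sup>+f. weight E f \<partial>(coord_lebesgue :: ('m::finite \<Rightarrow> real) measure)) < \<infinity>"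
proof -
  fix i :: 'm
  let ?J = "UNIV - {i}"
  let ?B = "\<Pi>\<^sub>E j\<in>?J. {0<..<E}"
  have B: "?B \<in> sets (Pi\<^sub>M ?J (\<lambda>_. lborel))" by (intro sets_PiM_I_finite) auto
  have "(\<integral>\<^sup>+f. weight E f \<partial>(coord_lebesgue :: ('m \<Rightarrow> real) measure)) = (\<integral>\<^sup>+f. (\<integral>\<^sup>+x. weight E (f(i := x)) \<partial>lborel) \<partial>Pi\<^sub>M ?J (\<lambda>_. lborel))"
    by (rule nn_integral_coordinate[OF measurable_weight])
  also have "\<dots> \<le> (\<integral>\<^sup>+f. ennreal (2 * sqrt E) * indicator ?B f \<partial>Pi\<^sub>M ?J (\<lambda>_. lborel))"
  proof (rule nn_integral_mono)
    fix f :: "'m \<Rightarrow> real" assume "f \<in> space (Pi\<^sub>M ?J (\<lambda>_. lborel))"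
    then have ext: "f \<in> extensional ?J" unfolding space_PiM PiE_iff by (rule conjunct2)
    let ?S = "pair_energy E i f"
    show "(\<integral>\<^sup>+x. weight E (f(i := x)) \<partial>lborel) \<le> ennreal (2 * sqrt E) * indicator ?B f"
    proof (cases "(\<forall>j. j \<noteq> i \<longrightarrow> 0 < f j) \<and> 0 < ?S")
      case True
      then have pos: "\<forall>j. j \<noteq> i \<longrightarrow> 0 < f j" and S: "0 < ?S" by auto
      have "f j < E" if "j \<noteq> i" for j
      proof -
        have "f j \<le> sum f ?J" using pos that by (intro member_le_sum) (auto intro: less_imp_le)
        then show ?thesis using S by (simp add: pair_energy_def)
      qed
      then have fB: "f \<in> ?B" using pos ext by (auto simp: PiE_iff)
      have "(\<integral>\<^sup>+x. weight E (f(i := x)) \<partial>lborel)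
        = (\<integral>\<^sup>+x. ennreal 2 * (ennreal (1 / (2 * sqrt (?S - x))) * indicator {?S - ?S<..<?S} x) \<partial>lborel)"
      proof (rule nn_integral_cong)
        fix x
        have "ennreal (1 / sqrt (?S - x)) = ennreal 2 * ennreal (1 / (2 * sqrt (?S - x)))" if "x < ?S"
          using that by (subst ennreal_mult[symmetric]) auto
        then show "weight E (f(i := x)) = ennreal 2 * (ennreal (1 / (2 * sqrt (?S - x))) * indicator {?S - ?S<..<?S} x)"
          using pos by (auto simp: weight_upd split: split_indicator)
      qed
      also have "\<dots> = ennreal 2 * ennreal (sqrt ?S)"
        using nn_integral_inverse_sqrt[OF S, of ?S] by (simp add: nn_integral_cmult)
      also have "\<dots> = ennreal (2 * sqrt ?S)"
        using S by (subst ennreal_mult) auto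
      also have "\<dots> \<le> ennreal (2 * sqrt E)"
      proof -
        have "0 \<le> sum f ?J" using pos by (intro sum_nonneg) (auto intro: less_imp_le)
        then show ?thesis by (intro ennreal_leI) (simp add: pair_energy_def)
      qed
      finally show ?thesis using fB by simp
    next
      case False
      then have "weight E (f(i := x)) = 0" for x
        by (auto simp: weight_upd split: split_indicator)
      then show ?thesis by simp
    qed
  qed
  also have "\<dots> = ennreal (2 * sqrt E) * (\<Prod>j\<in>?J. emeasure lborel {0<..<E})"
    using B by (subst nn_integral_cmult_indicator) (auto simp: coord_lebesgue.emeasure_PiM)
  also have "\<dots> < \<infinity>"
  proof -
    have "emeasure lborel {0<..<E} = ennreal (max 0 E)" by (cases "0 \<le> E") auto
    then have "(\<Prod>j\<in>?J. emeasure lborel {0<..<E}) = ennreal (\<Prod>j\<in>?J. max 0 E)"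
      by (simp only: prod_ennreal)
    then show ?thesis by (simp add: ennreal_mult_less_top)
  qed
  finally show ?thesis .
qed

lemma coord_box_not_null:
  assumes "0 < d" "(\<Pi>\<^sub>E i\<in>UNIV. {0<..<d}) \<subseteq> X"
  shows "\<not> (AE f in coord_lebesgue. (f :: 'm::finite \<Rightarrow> real) \<notin> X)"
proof
  let ?B = "(\<Pi>\<^sub>E i\<in>(UNIV :: 'm set). {0<..<d})"
  assume "AE f in coord_lebesgue. (f :: 'm \<Rightarrow> real) \<notin> X"
  then have "AE f in coord_lebesgue. f \<notin> ?B"
    by eventually_elim (use assms in auto)
  moreover have "?B \<in> sets coord_lebesgue" by (intro sets_PiM_I_finite) auto
  ultimately have "emeasure coord_lebesgue ?B = 0"
    by (simp add: AE_iff_measurable[OF _ refl] space_PiM)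
  moreover have "emeasure coord_lebesgue ?B = (\<Prod>i\<in>(UNIV :: 'm set). ennreal d)"
    using assms by (subst coord_lebesgue.emeasure_PiM) auto
  ultimately show False using assms by (simp add: prod_ennreal)
qed

lemma small_box_coord_simplex:
  assumes "0 < E"
  shows "(\<Pi>\<^sub>E i\<in>(UNIV :: 'm::finite set). {0<..<E / CARD('m)}) \<subseteq> coord_simplex E"
proof
  fix f :: "'m \<Rightarrow> real" assume f: "f \<in> (\<Pi>\<^sub>E i\<in>UNIV. {0<..<E / CARD('m)})"
  then have "sum f UNIV < (\<Sum>i\<in>(UNIV :: 'm set). E / CARD('m))"
    by (intro sum_strict_mono) (auto simp: PiE_iff)
  with f show "f \<in> coord_simplex E" by (auto simp: coord_simplex_def PiE_iff)
qed

lemma weight_mass_pos: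
  assumes "0 < E"
  shows "0 < (\<integral>\<^sup>+f. weight E f \<partial>(coord_lebesgue :: ('m::finite \<Rightarrow> real) measure))"
proof (rule ccontr)
  assume "\<not> ?thesis"
  then have "AE f in (coord_lebesgue :: ('m \<Rightarrow> real) measure). weight E f = 0"
    by (subst (asm) zero_less_iff_neq_zero) (simp add: nn_integral_0_iff_AE measurable_weight)
  then have "AE f in (coord_lebesgue :: ('m \<Rightarrow> real) measure). f \<notin> coord_simplex E"
    by eventually_elim (auto simp: weight_def coord_simplex_def)
  moreover have "0 < E / CARD('m)" using assms by simp
  ultimately show False
    using coord_box_not_null[OF _ small_box_coord_simplex[OF assms, where 'm = 'm]] by blast
qed

text \<open>
  The constant is the inverse of the normalizing integral, which is thereby seen to be neither zero nor
  infinite.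
\<close>

lemma equilibrium_coordinates:
  assumes E: "0 < E"
  obtains c :: ennreal where "c * (\<integral>\<^sup>+f. weight E f \<partial>(coord_lebesgue :: ('m::finite \<Rightarrow> real) measure)) = 1" "c < \<infinity>"
    "\<And>g. g \<in> borel_measurable (simplex_space E) \<Longrightarrow>
      (\<integral>\<^sup>+z. g z \<partial>(equilibrium E :: 'm state measure)) = c * (\<integral>\<^sup>+f. weight E f * g (state_of E f) \<partial>coord_lebesgue)"
proof
  define I where "I = (\<integral>\<^sup>+f. weight E f \<partial>(coord_lebesgue :: ('m \<Rightarrow> real) measure))"
  define Z where "Z = (\<integral>z. snd z powr (- 1 / 2) \<partial>(simplex_lebesgue E :: 'm state measure))"
  have powr: "x powr (- 1 / 2) = 1 / sqrt x" if "0 < x" for x :: real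
    using powr_minus_divide[of x "1/2"] powr_half_sqrt[of x] that by simp
  have sets: "sets (simplex_lebesgue E) = sets (simplex_space E)"
    by (simp add: simplex_lebesgue_def)
  have snd: "(snd :: 'm state \<Rightarrow> real) \<in> borel_measurable (simplex_space E)"
    unfolding simplex_space_def by (intro measurable_restrict_space1 borel_measurable_snd_state)
  have pm: "(\<lambda>z::'m state. snd z powr (- 1 / 2)) \<in> borel_measurable (simplex_space E)"
    using snd by measurable
  have "Z = enn2real (\<integral>\<^sup>+z. ennreal (snd z powr (- 1 / 2)) \<partial>(simplex_lebesgue E :: 'm state measure))"
    unfolding Z_def using pm by (intro integral_eq_nn_integral) (auto simp: measurable_cong_sets[OF sets refl])
  also have "(\<integral>\<^sup>+z. ennreal (snd z powr (- 1 / 2)) \<partial>(simplex_lebesgue E :: 'm state measure)) = I"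
    unfolding I_def
    by (subst nn_integral_simplex_lebesgue)
      (use pm in \<open>auto intro!: nn_integral_cong simp: weight_def coord_simplex_def powr[simplified] split: split_indicator\<close>)
  finally have Z: "Z = enn2real I" .
  have I: "0 < I" "I < \<infinity>"
    using weight_mass_pos[OF E] weight_mass_finite by (simp_all add: I_def)
  then have IZ: "I = ennreal Z" "0 < Z" by (auto simp: Z enn2real_positive_iff)
  show "ennreal (1 / Z) * (\<integral>\<^sup>+f. weight E f \<partial>(coord_lebesgue :: ('m \<Rightarrow> real) measure)) = 1"
    unfolding I_def[symmetric] IZ(1) using IZ(2) by (simp add: ennreal_mult[symmetric])
  show "ennreal (1 / Z) < \<infinity>" by simp
  fix g :: "'m state \<Rightarrow> ennreal" assume g: "g \<in> borel_measurable (simplex_space E)"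
  have m: "(\<lambda>z::'m state. ennreal (1 / Z * snd z powr (- 1 / 2))) \<in> borel_measurable (simplex_space E)"
    using pm by measurable
  have ml: "(\<lambda>z. h (state_of E z)) \<in> borel_measurable coord_lebesgue"
    if "h \<in> borel_measurable borel" for h :: "'m state \<Rightarrow> ennreal"
    using measurable_compose[OF measurable_state_of that] .
  have "(\<lambda>z. g z * indicator (simplex_set E) z) \<in> borel_measurable borel"
    using g unfolding simplex_space_def by (subst (asm) borel_measurable_restrict_space_iff_ennreal) auto
  from ml[OF this] have gs: "(\<lambda>f. g (state_of E f) * indicator (simplex_set E) (state_of E f)) \<in> borel_measurable coord_lebesgue" .
  have "(\<integral>\<^sup>+z. g z \<partial>equilibrium E) = (\<integral>\<^sup>+z. ennreal (1 / Z * snd z powr (- 1 / 2)) * g z \<partial>simplex_lebesgue E)"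
    unfolding equilibrium_def Let_def Z_def[symmetric]
    by (intro nn_integral_density; subst measurable_cong_sets[OF sets refl]) (fact m g)+
  also have "\<dots> = (\<integral>\<^sup>+f. ennreal (1 / Z * snd (state_of E f) powr (- 1 / 2)) * g (state_of E f) * indicator (coord_simplex E) f \<partial>coord_lebesgue)"
    by (intro nn_integral_simplex_lebesgue borel_measurable_times_ennreal m g)
  also have "\<dots> = (\<integral>\<^sup>+f. ennreal (1 / Z) * (weight E f * (g (state_of E f) * indicator (simplex_set E) (state_of E f))) \<partial>coord_lebesgue)"
  proof (rule nn_integral_cong)
    fix f :: "'m \<Rightarrow> real"
    have "ennreal (1 / Z * (E - sum f UNIV) powr (- 1 / 2)) = ennreal (1 / Z) * ennreal (1 / sqrt (E - sum f UNIV))"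
      if "f \<in> coord_simplex E"
      using IZ(2) that by (subst ennreal_mult[symmetric]) (auto simp: coord_simplex_def powr[simplified])
    then show "ennreal (1 / Z * snd (state_of E f) powr (- 1 / 2)) * g (state_of E f) * indicator (coord_simplex E) f
      = ennreal (1 / Z) * (weight E f * (g (state_of E f) * indicator (simplex_set E) (state_of E f)))"
      by (auto simp: weight_def mult.assoc split: split_indicator)
  qed
  also have "\<dots> = ennreal (1 / Z) * (\<integral>\<^sup>+f. weight E f * (g (state_of E f) * indicator (simplex_set E) (state_of E f)) \<partial>coord_lebesgue)"
    by (intro nn_integral_cmult borel_measurable_times_ennreal measurable_weight gs)
  also have "(\<integral>\<^sup>+f. weight E f * (g (state_of E f) * indicator (simplex_set E) (state_of E f)) \<partial>coord_lebesgue)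
    = (\<integral>\<^sup>+f. weight E f * g (state_of E f) \<partial>coord_lebesgue)"
    by (intro nn_integral_cong) (auto simp: weight_def split: split_indicator)
  finally show "(\<integral>\<^sup>+z. g z \<partial>equilibrium E) = ennreal (1 / Z) * (\<integral>\<^sup>+f. weight E f * g (state_of E f) \<partial>coord_lebesgue)" .
qed


lemma borel_measurable_simplex_space:
  "g \<in> borel_measurable borel \<Longrightarrow> g \<in> borel_measurable (simplex_space E)"
  unfolding simplex_space_def by (rule measurable_restrict_space1)

lemma sets_equilibrium[simp]: "sets (equilibrium E) = sets (simplex_space E)"
  by (simp add: equilibrium_def Let_def simplex_lebesgue_def)

lemma space_equilibrium[simp]: "space (equilibrium E) = simplex_set E"
  using sets_eq_imp_space_eq[OF sets_equilibrium] by simp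

lemma prob_space_equilibrium:
  assumes E: "0 < E"
  shows "prob_space (equilibrium E :: 'm::finite state measure)"
proof (rule equilibrium_coordinates[OF E, where 'm = 'm])
  fix c assume c: "c * (\<integral>\<^sup>+f. weight E f \<partial>(coord_lebesgue :: ('m \<Rightarrow> real) measure)) = 1"
    and eq: "\<And>g. g \<in> borel_measurable (simplex_space E) \<Longrightarrow>
      (\<integral>\<^sup>+z. g z \<partial>(equilibrium E :: 'm state measure)) = c * (\<integral>\<^sup>+f. weight E f * g (state_of E f) \<partial>coord_lebesgue)"
  show ?thesis
    using eq[of "\<lambda>_. 1"] c by (intro prob_spaceI) simp
qed

text \<open>
  Stationarity at the level of the rates: mean loss equals mean gain.
\<close>

lemma equilibrium_balance:
  assumes E: "0 < E" and v[measurable]: "v \<in> borel_measurable (borel :: 'm::finite state measure)"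
  shows "(\<integral>\<^sup>+z. ennreal (total_rate z) * v z \<partial>equilibrium E) = (\<integral>\<^sup>+z. gain v z \<partial>equilibrium E)"
proof (rule equilibrium_coordinates[OF E, where 'm = 'm])
  fix c assume eq: "\<And>g. g \<in> borel_measurable (simplex_space E) \<Longrightarrow>
      (\<integral>\<^sup>+z. g z \<partial>(equilibrium E :: 'm state measure)) = c * (\<integral>\<^sup>+f. weight E f * g (state_of E f) \<partial>coord_lebesgue)"
  define K where "K i f = (\<integral>\<^sup>+t. v (state_of E (f(i := t))) * ennreal (1 / (2 * sqrt (pair_energy E i f - t)))
        * indicator {pair_energy E i f - f i<..<pair_energy E i f} t \<partial>lborel)" for i f
  have vs: "(\<lambda>f. v (state_of E f)) \<in> borel_measurable coord_lebesgue"
    using measurable_compose[OF measurable_state_of v] .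
  have "(\<lambda>z. ennreal (total_rate z) * v z) \<in> borel_measurable (borel :: 'm state measure)"
    unfolding total_rate_def by measurable
  then have "(\<integral>\<^sup>+z. ennreal (total_rate z) * v z \<partial>equilibrium E)
    = c * (\<integral>\<^sup>+f. weight E f * (ennreal (total_rate (state_of E f)) * v (state_of E f)) \<partial>coord_lebesgue)"
    by (intro eq borel_measurable_simplex_space)
  also have "(\<integral>\<^sup>+f. weight E f * (ennreal (total_rate (state_of E f)) * v (state_of E f)) \<partial>coord_lebesgue)
    = (\<integral>\<^sup>+f. (\<Sum>i\<in>UNIV. weight E f * (ennreal (sqrt (f i)) * v (state_of E f))) \<partial>coord_lebesgue)"
  proof (rule nn_integral_cong)
    fix f :: "'m \<Rightarrow> real"
    have "(\<Sum>i\<in>UNIV. ennreal (sqrt (f i))) = ennreal (total_rate (state_of E f))" if "f \<in> coord_simplex E"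
      using that unfolding total_rate_state_of by (intro sum_ennreal) (auto simp: coord_simplex_def intro: less_imp_le)
    then show "weight E f * (ennreal (total_rate (state_of E f)) * v (state_of E f))
      = (\<Sum>i\<in>UNIV. weight E f * (ennreal (sqrt (f i)) * v (state_of E f)))"
      by (cases "f \<in> coord_simplex E") (simp_all add: weight_def sum_distrib_left[symmetric] sum_distrib_right[symmetric])
  qed
  also have "\<dots> = (\<Sum>i\<in>UNIV. \<integral>\<^sup>+f. weight E f * (ennreal (sqrt (f i)) * v (state_of E f)) \<partial>coord_lebesgue)"
    using vs measurable_weight measurable_component_lebesgue
    by (intro nn_integral_sum borel_measurable_times_ennreal) (auto intro: measurable_compose[OF measurable_component_lebesgue])
  also have "\<dots> = (\<Sum>i\<in>UNIV. \<integral>\<^sup>+f. weight E f * K i f \<partial>coord_lebesgue)"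
    unfolding K_def by (intro sum.cong refl balance vs)
  also have "\<dots> = (\<integral>\<^sup>+f. (\<Sum>i\<in>UNIV. weight E f * K i f) \<partial>coord_lebesgue)"
    using measurable_weight borel_measurable_line_average[OF vs]
    by (intro nn_integral_sum[symmetric] borel_measurable_times_ennreal) (auto simp: K_def)
  also have "\<dots> = (\<integral>\<^sup>+f. weight E f * gain v (state_of E f) \<partial>coord_lebesgue)"
  proof (rule nn_integral_cong)
    fix f :: "'m \<Rightarrow> real"
    show "(\<Sum>i\<in>UNIV. weight E f * K i f) = weight E f * gain v (state_of E f)"
      by (cases "f \<in> coord_simplex E") (simp_all add: gain_state_of[OF _ v] K_def sum_distrib_left weight_def)
  qed
  also have "c * \<dots> = (\<integral>\<^sup>+z. gain v z \<partial>equilibrium E)"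
  proof (rule eq[symmetric], rule borel_measurable_simplex_space)
    have "(\<lambda>p. v (snd p)) \<in> borel_measurable (borel \<Otimes>\<^sub>M (borel :: 'm state measure))"
      by measurable
    from borel_measurable_gain[of "\<lambda>_. v", OF this] show "gain v \<in> borel_measurable borel"
      using measurable_compose[of "\<lambda>z. (0::real, z)" borel "borel \<Otimes>\<^sub>M borel" "\<lambda>p. gain v (snd p)" borel] by simp
  qed
  finally show ?thesis .
qed

lemma borel_measurable_simplex_pair:
  assumes "(\<lambda>p. h (fst p) (snd p)) \<in> borel_measurable (borel \<Otimes>\<^sub>M (borel :: 'm::finite state measure))"
    and "sets M = sets (simplex_space E)"
  shows "(\<lambda>(r, z). h (r::real) z :: ennreal) \<in> borel_measurable (lborel \<Otimes>\<^sub>M M)"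
proof -
  have id: "(\<lambda>z. z) \<in> M \<rightarrow>\<^sub>M (borel :: 'm state measure)"
    using assms(2) by (simp add: measurable_cong_sets[OF assms(2) refl] simplex_space_def measurable_restrict_space1)
  have "(\<lambda>p. (fst p, snd p)) \<in> lborel \<Otimes>\<^sub>M M \<rightarrow>\<^sub>M borel \<Otimes>\<^sub>M borel"
    by (intro measurable_Pair measurable_compose[OF measurable_snd id] measurable_compose[OF measurable_fst]) simp
  from measurable_compose[OF this assms(1)] show ?thesis by (simp add: case_prod_beta')
qed

lemma occupation_le_1: "occupation A t (z :: 'm::finite state) \<le> 1"
proof -
  have "occupation A t z \<le> (\<integral>\<^sup>+\<omega>. 1 \<partial>(paths :: 'm noise stream measure))"
    unfolding occupation_def by (intro nn_integral_mono) (auto split: split_indicator)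
  then show ?thesis by (simp add: paths.emeasure_space_1)
qed

text \<open>
  The integrated backward equation is averaged over the equilibrium. The two time integrals have the
  same finite mean by the balance of gain and loss, and cancel.
\<close>

lemma equilibrium_occupation:
  assumes E: "0 < E" and A: "A \<in> sets (simplex_space E :: 'm::finite state measure)" and t: "0 < t"
  shows "(\<integral>\<^sup>+z. occupation A t z \<partial>equilibrium E) = emeasure (equilibrium E) A"
proof -
  let ?pi = "equilibrium E :: 'm state measure"
  interpret pi: prob_space ?pi using E by (rule prob_space_equilibrium)
  interpret P: pair_sigma_finite lborel ?pi ..
  have Ab[measurable]: "A \<in> sets borel" using A by (simp add: sets_simplex_space)
  note occ = measurable_occupation[OF Ab]
  have occ_t: "occupation A r \<in> borel_measurable borel" for r
    using measurable_compose[of "\<lambda>z. (r, z)" borel "borel \<Otimes>\<^sub>M borel", OF _ occ] by simp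
  have meas: "g \<in> borel_measurable ?pi" if "g \<in> borel_measurable borel" for g :: "'m state \<Rightarrow> ennreal"
    using borel_measurable_simplex_space[OF that] by (simp add: measurable_cong_sets[OF sets_equilibrium refl])
  have rate: "(\<lambda>z::'m state. ennreal (total_rate z)) \<in> borel_measurable borel"
    unfolding total_rate_def by measurable
  define L where "L r z = ennreal (total_rate z) * occupation A r z * indicator {0<..<t} r" for r z
  define R where "R r z = gain (occupation A r) z * indicator {0<..<t} r" for r z
  have L2: "(\<lambda>p. L (fst p) (snd p)) \<in> borel_measurable (borel \<Otimes>\<^sub>M (borel :: 'm state measure))"
    unfolding L_def using occ measurable_compose[OF measurable_snd rate] by measurable
  have R2: "(\<lambda>p. R (fst p) (snd p)) \<in> borel_measurable (borel \<Otimes>\<^sub>M (borel :: 'm state measure))"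
    unfolding R_def using borel_measurable_gain[OF occ] by measurable
  have Lz: "(\<lambda>z. \<integral>\<^sup>+r. L r z \<partial>lborel) \<in> borel_measurable ?pi"
    and Rz: "(\<lambda>z. \<integral>\<^sup>+r. R r z \<partial>lborel) \<in> borel_measurable ?pi"
    using lborel.borel_measurable_nn_integral[OF measurable_pair_swap[OF borel_measurable_simplex_pair[OF L2 sets_equilibrium]]]
      lborel.borel_measurable_nn_integral[OF measurable_pair_swap[OF borel_measurable_simplex_pair[OF R2 sets_equilibrium]]]
    by simp_all
  have "(\<integral>\<^sup>+z. (\<integral>\<^sup>+r. L r z \<partial>lborel) \<partial>?pi) + (\<integral>\<^sup>+z. occupation A t z \<partial>?pi)
    = (\<integral>\<^sup>+z. (\<integral>\<^sup>+r. L r z \<partial>lborel) + occupation A t z \<partial>?pi)"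
    using Lz meas[OF occ_t] by (rule nn_integral_add[symmetric])
  also have "\<dots> = (\<integral>\<^sup>+z. indicator A z + (\<integral>\<^sup>+r. R r z \<partial>lborel) \<partial>?pi)"
    unfolding L_def R_def using integrated_backward_equation[OF _ Ab t] by (intro nn_integral_cong) auto
  also have "\<dots> = (\<integral>\<^sup>+z. indicator A z \<partial>?pi) + (\<integral>\<^sup>+z. (\<integral>\<^sup>+r. R r z \<partial>lborel) \<partial>?pi)"
    by (rule nn_integral_add[OF meas Rz]) (rule borel_measurable_indicator[OF Ab])
  also have "(\<integral>\<^sup>+z. indicator A z \<partial>?pi) = emeasure ?pi A"
    using A by simp
  also have "(\<integral>\<^sup>+z. (\<integral>\<^sup>+r. R r z \<partial>lborel) \<partial>?pi) = (\<integral>\<^sup>+r. (\<integral>\<^sup>+z. R r z \<partial>?pi) \<partial>lborel)"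
    by (rule P.Fubini'[OF borel_measurable_simplex_pair[OF R2 sets_equilibrium]])
  also have "\<dots> = (\<integral>\<^sup>+r. (\<integral>\<^sup>+z. L r z \<partial>?pi) \<partial>lborel)"
  proof (rule nn_integral_cong)
    fix r
    show "(\<integral>\<^sup>+z. R r z \<partial>?pi) = (\<integral>\<^sup>+z. L r z \<partial>?pi)"
      using equilibrium_balance[OF E occ_t[of r]] by (cases "r \<in> {0<..<t}") (simp_all add: L_def R_def)
  qed
  also have "\<dots> = (\<integral>\<^sup>+z. (\<integral>\<^sup>+r. L r z \<partial>lborel) \<partial>?pi)"
    by (rule P.Fubini'[symmetric, OF borel_measurable_simplex_pair[OF L2 sets_equilibrium]])
  finally have "(\<integral>\<^sup>+z. (\<integral>\<^sup>+r. L r z \<partial>lborel) \<partial>?pi) + (\<integral>\<^sup>+z. occupation A t z \<partial>?pi)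
    = (\<integral>\<^sup>+z. (\<integral>\<^sup>+r. L r z \<partial>lborel) \<partial>?pi) + emeasure ?pi A"
    by (simp add: add.commute)
  moreover have "(\<integral>\<^sup>+z. (\<integral>\<^sup>+r. L r z \<partial>lborel) \<partial>?pi) \<noteq> \<infinity>"
  proof -
    have "(\<integral>\<^sup>+z. (\<integral>\<^sup>+r. L r z \<partial>lborel) \<partial>?pi)
      \<le> (\<integral>\<^sup>+z. (\<integral>\<^sup>+r. ennreal (real CARD('m) * sqrt E) * indicator {0<..<t} r \<partial>lborel) \<partial>?pi)"
    proof (intro nn_integral_mono)
      fix z :: "'m state" and r assume "z \<in> space ?pi"
      then have "ennreal (total_rate z) * occupation A r z \<le> ennreal (real CARD('m) * sqrt E) * 1"
        by (intro mult_mono ennreal_leI total_rate_le occupation_le_1) auto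
      then show "L r z \<le> ennreal (real CARD('m) * sqrt E) * indicator {0<..<t} r"
        by (auto simp: L_def split: split_indicator)
    qed
    also have "\<dots> = ennreal (real CARD('m) * sqrt E) * ennreal t"
      using t by (simp add: nn_integral_cmult_indicator pi.emeasure_space_1[unfolded space_equilibrium])
    also have "\<dots> < \<infinity>" by (simp add: ennreal_mult_less_top)
    finally show ?thesis by simp
  qed
  ultimately show ?thesis by (simp add: ennreal_add_left_cancel)
qed

lemma evolved_eq:
  assumes "sets \<mu> = sets (simplex_space E)" "A \<in> sets (simplex_space E)"
  shows "evolved E \<mu> t A = (\<integral>\<^sup>+z. occupation A t z \<partial>\<mu>)"
  unfolding evolved_def
  using assms sets_eq_imp_space_eq[OF assms(1)] by (intro nn_integral_cong) (auto simp: emeasure_transition)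

lemma invariant_equilibrium:
  assumes "0 < E"
  shows "invariant_prob E (equilibrium E :: 'm::finite state measure)"
  unfolding invariant_prob_def prob_on_simplex_def
  using assms by (simp add: prob_space_equilibrium evolved_eq equilibrium_occupation)

section \<open>Irreducibility\<close>

lemma interval_not_null:
  fixes a b :: real assumes "a < b"
  shows "\<not> (AE t in lborel. t \<notin> {a<..<b})"
proof
  assume "AE t in lborel. t \<notin> {a<..<b}"
  moreover have "{t \<in> space lborel. \<not> t \<notin> {a<..<b}} = {a<..<b}" by auto
  ultimately have "emeasure lborel {a<..<b} = 0"
    using AE_iff_measurable[of "{a<..<b}" lborel "\<lambda>t. t \<notin> {a<..<b}"] by simp
  then show False using assms by simp
qed

definition reaching :: "real \<Rightarrow> 'm::finite state set \<Rightarrow> ('m \<Rightarrow> real) set" where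
  "reaching E A = {f \<in> coord_simplex E. \<forall>t>0. 0 < occupation A t (state_of E f)}"

text \<open>
  With positive probability no ring occurs before \<open>t\<close>.
\<close>

lemma target_subset_reaching:
  assumes A: "A \<in> sets borel" and f: "f \<in> coord_simplex E" "state_of E f \<in> A"
  shows "f \<in> reaching E A"
proof -
  have "0 < occupation A t (state_of E f)" if "0 < t" for t
  proof -
    have "0 < ennreal (exp (- (total_rate (state_of E f) * t)))" by simp
    also have "\<dots> \<le> occupation A t (state_of E f)"
      using f by (subst backward_equation[OF _ A that, of _ E]) (auto intro: order_trans[OF _ add_increasing2])
    finally show ?thesis .
  qed
  then show ?thesis using f by (simp add: reaching_def)
qed

text \<open>
  A ring of \<open>i\<close> moves its energy \<open>f i\<close> to a value in \<open>(S - f i, S)\<close> with a positive density there, where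
  \<open>S\<close> is the pair energy. If a positive part of this segment reaches the target, then the gain is
  positive at all times, and so is the integral in the backward equation.
\<close>

lemma reaching_step:
  assumes A: "A \<in> sets (borel :: 'm::finite state measure)" and f: "f \<in> coord_simplex E"
    and nonnull: "\<not> (AE x in lborel. \<not> (pair_energy E i f - f i < x \<and> f(i := x) \<in> reaching E A))"
  shows "f \<in> reaching E A"
proof -
  have occ: "occupation A r \<in> borel_measurable borel" for r
    using measurable_compose[of "\<lambda>z. (r, z)" borel "borel \<Otimes>\<^sub>M borel", OF _ measurable_occupation[OF A]] by simp
  have gain_pos: "gain (occupation A r) (state_of E f) \<noteq> 0" if r: "0 < r" for r
  proof
    define K where "K i x = occupation A r (state_of E (f(i := x))) * ennreal (1 / (2 * sqrt (pair_energy E i f - x)))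
      * indicator {pair_energy E i f - f i<..<pair_energy E i f} x" for i x
    assume "gain (occupation A r) (state_of E f) = 0"
    then have "(\<integral>\<^sup>+x. K i x \<partial>lborel) = 0"
      by (simp add: gain_state_of[OF f occ] K_def)
    moreover have "K i \<in> borel_measurable borel"
    proof -
      have "(\<lambda>t. f(i := t)) \<in> borel \<rightarrow>\<^sub>M (coord_lebesgue :: ('m \<Rightarrow> real) measure)"
        by (rule measurable_fun_upd[where J = UNIV]) (auto simp: space_PiM)
      from measurable_compose[OF measurable_compose[OF this measurable_state_of] occ]
      have "(\<lambda>x. occupation A r (state_of E (f(i := x)))) \<in> borel_measurable borel" .
      then show ?thesis unfolding K_def by measurable
    qed
    ultimately have "AE x in lborel. K i x = 0"
      by (simp add: nn_integral_0_iff_AE)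
    then have "AE x in lborel. \<not> (pair_energy E i f - f i < x \<and> f(i := x) \<in> reaching E A)"
    proof eventually_elim
      case (elim x)
      show ?case
      proof safe
        assume x: "pair_energy E i f - f i < x" and reach: "f(i := x) \<in> reaching E A"
        have "x < pair_energy E i f" using reach by (auto simp: reaching_def coord_simplex_upd simp del: fun_upd_apply)
        moreover have "occupation A r (state_of E (f(i := x))) \<noteq> 0"
          using reach r by (auto simp: reaching_def)
        ultimately show False using elim x by (simp add: K_def)
      qed
    qed
    with nonnull show False by simp
  qed
  have "0 < occupation A t (state_of E f)" if t: "0 < t" for t
  proof (rule ccontr)
    define g where "g r = ennreal (exp (- (total_rate (state_of E f) * (t - r)))) * gain (occupation A r) (state_of E f) * indicator {0<..<t} r" for r
    assume "\<not> ?thesis"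
    then have "(\<integral>\<^sup>+r. g r \<partial>lborel) = 0"
      using f by (simp add: backward_equation[OF _ A t, of _ E] g_def)
    moreover have "g \<in> borel_measurable borel"
    proof -
      have "(\<lambda>r. gain (occupation A r) (state_of E f)) \<in> borel_measurable borel"
        using measurable_compose[OF _ borel_measurable_gain[OF measurable_occupation[OF A]], of "\<lambda>r. (r, state_of E f)" borel] by simp
      then show ?thesis unfolding g_def by measurable
    qed
    ultimately have "AE r in lborel. g r = 0"
      by (simp add: nn_integral_0_iff_AE)
    then have "AE r in lborel. r \<notin> {0<..<t}"
    proof eventually_elim
      case (elim r)
      then show ?case using gain_pos[of r] by (auto simp: g_def)
    qed
    with interval_not_null[OF t] show False by simp
  qed
  with f show ?thesis by (simp add: reaching_def)
qed

lemma coord_simplex_pos: "f \<in> coord_simplex E \<Longrightarrow> 0 < f i"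
  by (simp add: coord_simplex_def)

text \<open>
  In contrast to \<open>reaching_step\<close>, the reaching part of the line may lie anywhere. A positive part
  of it lies above some \<open>e > 0\<close>, hence is accessible from all points above \<open>S - e\<close>. So the line reaches
  the target from everywhere near its end \<open>S\<close>, and this end is accessible from every point.
\<close>

lemma reaching_line:
  assumes A: "A \<in> sets (borel :: 'm::finite state measure)" and f: "f \<in> coord_simplex E"
    and nonnull: "\<not> (AE x in lborel. f(i := x) \<notin> reaching E A)"
  shows "f \<in> reaching E A"
proof -
  define S where "S = pair_energy E i f"
  have range: "0 < x \<and> x < S" if "f(i := x) \<in> reaching E A" for x
    using that by (auto simp: reaching_def coord_simplex_upd S_def simp del: fun_upd_apply)
  have in_simplex: "f(i := x) \<in> coord_simplex E" if "0 < x" "x < S" for x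
    using that by (simp add: coord_simplex_upd S_def coord_simplex_pos[OF f] del: fun_upd_apply)
  have "\<exists>n::nat. \<not> (AE x in lborel. \<not> (1 / Suc n < x \<and> f(i := x) \<in> reaching E A))"
  proof (rule ccontr)
    assume "\<not> ?thesis"
    then have "AE x in lborel. \<forall>n::nat. \<not> (1 / Suc n < x \<and> f(i := x) \<in> reaching E A)"
      unfolding AE_all_countable by blast
    then have "AE x in lborel. f(i := x) \<notin> reaching E A"
    proof eventually_elim
      case (elim x)
      then show ?case using range[of x] nat_approx_posE[of x] by metis
    qed
    with nonnull show False by simp
  qed
  then obtain n :: nat where n: "\<not> (AE x in lborel. \<not> (1 / Suc n < x \<and> f(i := x) \<in> reaching E A))" by blast
  define e where "e = 1 / Suc n"
  have e: "0 < e" by (simp add: e_def)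
  have "\<exists>x. e < x \<and> f(i := x) \<in> reaching E A"
    using n by (auto simp: e_def)
  then have eS: "e < S" using range by force
  have top: "f(i := x) \<in> reaching E A" if x: "S - e < x" "x < S" for x
  proof (rule reaching_step[OF A, where i = i])
    show "f(i := x) \<in> coord_simplex E" using x eS by (intro in_simplex) auto
    show "\<not> (AE y in lborel. \<not> (pair_energy E i (f(i := x)) - (f(i := x)) i < y \<and> f(i := x, i := y) \<in> reaching E A))"
    proof
      assume "AE y in lborel. \<not> (pair_energy E i (f(i := x)) - (f(i := x)) i < y \<and> f(i := x, i := y) \<in> reaching E A)"
      then have "AE y in lborel. \<not> (1 / Suc n < y \<and> f(i := y) \<in> reaching E A)"
      proof eventually_elim
        case (elim y)
        then show ?case using x by (auto simp: S_def[symmetric] e_def simp del: of_nat_Suc)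
      qed
      with n show False by simp
    qed
  qed
  show ?thesis
  proof (rule reaching_step[OF A f, where i = i])
    show "\<not> (AE x in lborel. \<not> (pair_energy E i f - f i < x \<and> f(i := x) \<in> reaching E A))"
    proof
      assume "AE x in lborel. \<not> (pair_energy E i f - f i < x \<and> f(i := x) \<in> reaching E A)"
      then have "AE x in lborel. x \<notin> {max (S - f i) (S - e)<..<S}"
      proof eventually_elim
        case (elim x)
        then show ?case using top[of x] by (auto simp: S_def)
      qed
      moreover have "max (S - f i) (S - e) < S"
        using f e by (auto simp: coord_simplex_def)
      ultimately show False using interval_not_null by blast
    qed
  qed
qed

lemma sum_upd_not_in: "j \<notin> J \<Longrightarrow> sum (f(j := y)) J = sum f J"
  by (rule sum.cong) auto

lemma sum_split_Compl:
  "sum (w :: 'm::finite \<Rightarrow> real) UNIV = sum w J + sum w (- J)"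
  by (subst sum.union_disjoint[symmetric]) (auto simp: Un_commute)

definition section_mass :: "(('m::finite \<Rightarrow> real) \<Rightarrow> ennreal) \<Rightarrow> 'm set \<Rightarrow> ('m \<Rightarrow> real) \<Rightarrow> ennreal" where
  "section_mass H J v = (\<integral>\<^sup>+x. H (\<lambda>i. if i \<in> J then x i else v i) \<partial>Pi\<^sub>M J (\<lambda>_. lborel))"

lemma section_mass_insert:
  assumes H: "H \<in> borel_measurable (coord_lebesgue :: ('m::finite \<Rightarrow> real) measure)" and j: "j \<notin> J"
  shows "section_mass H (insert j J) v = (\<integral>\<^sup>+y. section_mass H J (v(j := y)) \<partial>lborel)"
proof -
  have "(\<lambda>x i. if i \<in> insert j J then x i else v i) \<in> Pi\<^sub>M (insert j J) (\<lambda>_. lborel) \<rightarrow>\<^sub>M coord_lebesgue"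
  proof (rule measurable_PiM_single')
    show "(\<lambda>x. if i \<in> insert j J then x i else v i) \<in> Pi\<^sub>M (insert j J) (\<lambda>_. lborel) \<rightarrow>\<^sub>M lborel" for i
      by (cases "i \<in> insert j J") (simp_all add: measurable_component_singleton del: insert_iff)
  qed simp
  from measurable_compose[OF this H]
  have "section_mass H (insert j J) v = (\<integral>\<^sup>+y. (\<integral>\<^sup>+x. H (\<lambda>i. if i \<in> insert j J then (x(j := y)) i else v i) \<partial>Pi\<^sub>M J (\<lambda>_. lborel)) \<partial>lborel)"
    unfolding section_mass_def using j by (intro coord_lebesgue.product_nn_integral_insert_rev) auto
  also have "\<dots> = (\<integral>\<^sup>+y. section_mass H J (v(j := y)) \<partial>lborel)"
    unfolding section_mass_def
    using j by (intro nn_integral_cong arg_cong[of _ _ H]) (auto simp: fun_eq_iff)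
  finally show ?thesis .
qed

text \<open>
  If the target charges the section through \<open>v\<close> in the directions \<open>J\<close>, then it is reached from every
  state \<open>w\<close> that agrees with \<open>v\<close> off \<open>J\<close>. Induction on \<open>J\<close>: by Fubini's theorem a positive set of values
  \<open>y\<close> of the new coordinate \<open>j\<close> gives sections of positive mass, so the line through \<open>w\<close> in direction \<open>j\<close>
  contains a positive set of reaching states. These states have to lie in the simplex, although \<open>y\<close> is
  dictated by the target and the coordinates in \<open>J\<close> by \<open>w\<close>. This is why the target is restricted to
  states that leave an energy of more than \<open>\<epsilon>\<close> in the tank and \<open>w\<close> to less than \<open>\<epsilon>\<close> on \<open>J\<close>.
\<close>

lemma section_mass_reaching:
  fixes A :: "'m::finite state set" and E :: real
  defines "H \<equiv> \<lambda>\<epsilon>. indicator {f \<in> coord_simplex (E - \<epsilon>). state_of E f \<in> A}"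
  assumes A: "A \<in> sets borel" and \<epsilon>: "0 < \<epsilon>" and H: "H \<epsilon> \<in> borel_measurable coord_lebesgue"
    and J: "section_mass (H \<epsilon>) J v \<noteq> 0"
    and w: "w \<in> coord_simplex E" "\<And>i. i \<notin> J \<Longrightarrow> w i = v i" "sum w J < \<epsilon>"
  shows "w \<in> reaching E A"
proof -
  have "finite J" by simp
  then show ?thesis using J w
  proof (induction J arbitrary: v w)
    case empty
    have "section_mass (H \<epsilon>) {} v = H \<epsilon> v"
      unfolding section_mass_def by (subst coord_lebesgue.nn_integral_empty) simp_all
    with empty.prems(1) have "state_of E v \<in> A" by (auto simp: H_def split: split_indicator_asm)
    moreover have "w = v" using empty.prems(3) by auto
    ultimately show ?case using empty.prems(2) A by (auto intro: target_subset_reaching)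
  next
    case (insert j J)
    show ?case
    proof (rule reaching_line[OF A insert.prems(2), of j], rule notI)
      assume "AE y in lborel. w(j := y) \<notin> reaching E A"
      then have "AE y in lborel. section_mass (H \<epsilon>) J (v(j := y)) = 0"
      proof eventually_elim
        case (elim y)
        show ?case
        proof (rule ccontr)
          let ?u = "v(j := y)"
          assume nz: "section_mass (H \<epsilon>) J ?u \<noteq> 0"
          have "\<exists>x. H \<epsilon> (\<lambda>i. if i \<in> J then x i else ?u i) \<noteq> 0"
          proof (rule ccontr)
            assume "\<not> ?thesis"
            then have "section_mass (H \<epsilon>) J ?u = 0" by (simp add: section_mass_def)
            with nz show False by simp
          qed
          then obtain x where "(\<lambda>i. if i \<in> J then x i else ?u i) \<in> coord_simplex (E - \<epsilon>)"
            by (auto simp: H_def split: split_indicator_asm)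
          moreover define q where "q = (\<lambda>i. if i \<in> J then x i else ?u i)"
          ultimately have q: "\<And>i. 0 < q i" "sum q UNIV < E - \<epsilon>" by (auto simp: coord_simplex_def)
          have wu: "(w(j := y)) i = ?u i" if "i \<notin> J" for i
            using insert.prems(3)[of i] that by auto
          have "sum (w(j := y)) (- J) = sum q (- J)"
            using wu by (intro sum.cong) (auto simp: q_def)
          moreover have "sum q UNIV = sum q J + sum q (- J)" by (rule sum_split_Compl)
          moreover have "0 \<le> sum q J" using q(1) by (intro sum_nonneg) (auto intro: less_imp_le)
          moreover have wJ: "sum (w(j := y)) J < \<epsilon>"
          proof -
            have "sum (w(j := y)) J = sum w J" using insert.hyps by (rule_tac sum_upd_not_in) auto
            moreover have "0 < w j" using insert.prems(2) by (auto simp: coord_simplex_def)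
            ultimately show ?thesis using insert.prems(4) insert.hyps by simp
          qed
          moreover have "sum (w(j := y)) UNIV = sum (w(j := y)) J + sum (w(j := y)) (- J)"
            by (rule sum_split_Compl)
          ultimately have "sum (w(j := y)) UNIV < E" using q(2) by linarith
          moreover have "0 < y" using q(1)[of j] insert.hyps by (simp add: q_def)
          ultimately have "w(j := y) \<in> coord_simplex E"
            using insert.prems(2) by (auto simp: coord_simplex_def)
          moreover have "w(j := y) \<in> reaching E A" if "w(j := y) \<in> coord_simplex E"
            using nz that wu wJ by (rule insert.IH)
          ultimately show False using elim by blast
        qed
      qed
      then have "(\<integral>\<^sup>+y. section_mass (H \<epsilon>) J (v(j := y)) \<partial>lborel) = (\<integral>\<^sup>+y. 0 \<partial>(lborel :: real measure))"
        by (rule nn_integral_cong_AE)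
      then show False
        using insert.prems(1) section_mass_insert[OF H insert.hyps(2)] by simp
    qed
  qed
qed

text \<open>
  The smallness required of \<open>w\<close> is dropped for one coordinate after another: shrinking the coordinate
  \<open>j\<close> moves along a line, whose points with small \<open>j\<close> coordinate reach the target by induction.
\<close>

lemma reaching_extend:
  assumes A: "A \<in> sets (borel :: 'm::finite state measure)" and \<epsilon>: "0 < \<epsilon>"
    and small: "\<And>w. w \<in> coord_simplex E \<Longrightarrow> sum w UNIV < \<epsilon> \<Longrightarrow> w \<in> reaching E A"
    and w: "w \<in> coord_simplex E" "sum w (- J) < \<epsilon>"
  shows "w \<in> reaching E A"
proof -
  have "finite J" by simp
  then show ?thesis using w
  proof (induction J arbitrary: w)
    case empty
    then show ?case using small by (simp add: Compl_empty_eq)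
  next
    case (insert j J)
    define \<eta> where "\<eta> = min (\<epsilon> - sum w (- insert j J)) (w j)"
    have wj: "0 < w j" using insert.prems by (auto simp: coord_simplex_def)
    have \<eta>: "0 < \<eta>" using insert.prems wj by (simp add: \<eta>_def)
    have reach: "w(j := y) \<in> reaching E A" if y: "0 < y" "y < \<eta>" for y
    proof (rule insert.IH)
      have "w j < pair_energy E j w"
        using insert.prems(1) by (simp add: coord_simplex_def sum_pair_energy[of w j E])
      then show "w(j := y) \<in> coord_simplex E"
        using y by (simp add: coord_simplex_upd \<eta>_def coord_simplex_pos[OF insert.prems(1)] del: fun_upd_apply)
      have "- J = insert j (- insert j J)" using insert.hyps by auto
      then have "sum (w(j := y)) (- J) = y + sum (w(j := y)) (- insert j J)"
        by (simp del: fun_upd_apply Compl_insert) simp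
      also have "sum (w(j := y)) (- insert j J) = sum w (- insert j J)"
        by (rule sum_upd_not_in) simp
      finally show "sum (w(j := y)) (- J) < \<epsilon>" using y by (simp add: \<eta>_def)
    qed
    show ?case
    proof (rule reaching_line[OF A insert.prems(1), of j], rule notI)
      assume "AE y in lborel. w(j := y) \<notin> reaching E A"
      then have "AE y in lborel. y \<notin> {0<..<\<eta>}"
        by eventually_elim (use reach in auto)
      with interval_not_null[OF \<eta>] show False by simp
    qed
  qed
qed

text \<open>
  A target of positive measure still has positive measure after removing the states with at most some
  small \<open>\<epsilon>\<close> in the tank. The section in all directions is then the whole space.
\<close>

lemma irreducible:
  assumes E: "0 < E" and A: "A \<in> sets (simplex_space E)" and pos: "emeasure (equilibrium E :: 'm::finite state measure) A \<noteq> 0"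
    and z: "z \<in> simplex_set E" and t: "0 < t"
  shows "0 < occupation A t z"
proof -
  have Ab: "A \<in> sets borel" using A by (simp add: sets_simplex_space)
  define B where "B \<epsilon> = {f \<in> coord_simplex (E - \<epsilon>). state_of E f \<in> A}" for \<epsilon>
  have Bm: "B \<epsilon> \<in> sets coord_lebesgue" for \<epsilon>
  proof -
    have "B \<epsilon> = coord_simplex (E - \<epsilon>) \<inter> (state_of E -` A \<inter> space coord_lebesgue)"
      by (auto simp: B_def space_PiM)
    then show ?thesis
      by (simp only:) (intro sets.Int coord_simplex_measurable measurable_sets[OF measurable_state_of Ab])
  qed
  have "\<exists>n. emeasure coord_lebesgue (B (1 / Suc n)) \<noteq> 0"
  proof (rule ccontr)
    assume "\<not> ?thesis"
    then have "AE f in coord_lebesgue. f \<notin> B (1 / Suc n)" for n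
      using Bm by (subst AE_iff_measurable[OF _ refl]) (auto simp: space_PiM)
    then have "AE f in coord_lebesgue. \<forall>n::nat. f \<notin> B (1 / Suc n)"
      unfolding AE_all_countable by blast
    then have "AE f in coord_lebesgue. weight E f * indicator A (state_of E f) = 0"
    proof eventually_elim
      case (elim f)
      show ?case
      proof (cases "f \<in> coord_simplex E")
        case True
        then have "0 < E - sum f UNIV" by (simp add: coord_simplex_def)
        then obtain n where "1 / Suc n < E - sum f UNIV" by (rule nat_approx_posE)
        then have "f \<in> coord_simplex (E - 1 / Suc n)" using True by (simp add: coord_simplex_def)
        then have "state_of E f \<notin> A" using elim by (auto simp: B_def)
        then show ?thesis by simp
      qed (simp add: weight_def)
    qed
    then have "(\<integral>\<^sup>+f. weight E f * indicator A (state_of E f) \<partial>coord_lebesgue) = (\<integral>\<^sup>+f. 0 \<partial>(coord_lebesgue :: ('m \<Rightarrow> real) measure))"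
      by (rule nn_integral_cong_AE)
    then have null: "(\<integral>\<^sup>+f. weight E f * indicator A (state_of E f) \<partial>coord_lebesgue) = 0" by simp
    have "(\<integral>\<^sup>+z. indicator A z \<partial>(equilibrium E :: 'm state measure)) = 0"
    proof (rule equilibrium_coordinates[OF E, where 'm = 'm])
      fix c assume eq: "\<And>g. g \<in> borel_measurable (simplex_space E) \<Longrightarrow>
        (\<integral>\<^sup>+z. g z \<partial>(equilibrium E :: 'm state measure)) = c * (\<integral>\<^sup>+f. weight E f * g (state_of E f) \<partial>coord_lebesgue)"
      show ?thesis
        using eq[OF borel_measurable_indicator[OF A]] null by simp
    qed
    then show False using pos A by simp
  qed
  then obtain n where n: "emeasure coord_lebesgue (B (1 / Suc n)) \<noteq> 0" by blast
  define \<epsilon> where "\<epsilon> = 1 / real (Suc n)"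
  have \<epsilon>: "0 < \<epsilon>" by (simp add: \<epsilon>_def)
  have small: "w \<in> reaching E A" if "w \<in> coord_simplex E" "sum w UNIV < \<epsilon>" for w
  proof (rule section_mass_reaching[OF Ab \<epsilon>, where J = UNIV and v = w])
    show "indicator {f \<in> coord_simplex (E - \<epsilon>). state_of E f \<in> A} \<in> borel_measurable coord_lebesgue"
      using Bm[of \<epsilon>] by (simp add: B_def)
    have "section_mass (indicator (B \<epsilon>)) UNIV w = emeasure coord_lebesgue (B \<epsilon>)"
      using Bm[of \<epsilon>] by (simp add: section_mass_def)
    then show "section_mass (indicator {f \<in> coord_simplex (E - \<epsilon>). state_of E f \<in> A}) UNIV w \<noteq> 0"
      using n by (simp add: B_def \<epsilon>_def)
  qed (use that in auto)
  obtain f where f: "f \<in> coord_simplex E" "z = state_of E f" using simplex_setE[OF z] .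
  have "f \<in> reaching E A"
    by (rule reaching_extend[OF Ab \<epsilon> small f(1), of UNIV]) (use \<epsilon> in auto)
  then show ?thesis using t by (simp add: reaching_def f)
qed

section \<open>Uniqueness and ergodicity\<close>

text \<open>
  The defect of \<open>M\<close> against \<open>N\<close> is a measure that assigns integral zero to the positive function \<open>p\<close>, so
  it vanishes. The sets on which \<open>p\<close> is bounded away from zero make this precise without a difference of
  measures.
\<close>

lemma le_measure_eq_total_mass:
  assumes N: "finite_measure N" and sets: "sets M = sets N" and le: "M \<le> N"
    and p[measurable]: "p \<in> borel_measurable N" and pos: "\<And>x. x \<in> space N \<Longrightarrow> 0 < p x"
    and int: "(\<integral>\<^sup>+x. p x \<partial>N) \<le> (\<integral>\<^sup>+x. p x \<partial>M)" and fin: "(\<integral>\<^sup>+x. p x \<partial>N) < \<infinity>"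
  shows "emeasure N (space N) \<le> emeasure M (space N)"
proof -
  define B where "B n = {x \<in> space N. ennreal (1 / Suc n) \<le> p x}" for n :: nat
  have B[measurable]: "B n \<in> sets N" for n unfolding B_def by measurable
  have BM[measurable]: "B n \<in> sets M" for n using B sets by simp
  have pM[measurable]: "p \<in> borel_measurable M" using p by (simp add: measurable_cong_sets[OF sets refl])
  have "emeasure N (B n) \<le> emeasure M (B n)" for n
  proof -
    define k where "k = ennreal (1 / Suc n)"
    define g where "g x = p x - k * indicator (B n) x" for x
    have k: "k \<noteq> 0" "k \<noteq> \<infinity>" by (auto simp: k_def simp del: of_nat_Suc)
    have pg: "p x = g x + k * indicator (B n) x" for x
      by (auto simp: g_def B_def k_def diff_add_cancel_ennreal split: split_indicator)
    have gN[measurable]: "g \<in> borel_measurable N" unfolding g_def by measurable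
    have gM[measurable]: "g \<in> borel_measurable M" unfolding g_def by measurable
    have "(\<integral>\<^sup>+x. g x \<partial>N) + k * emeasure N (B n) = (\<integral>\<^sup>+x. p x \<partial>N)"
      unfolding pg by (subst nn_integral_add) (auto simp: nn_integral_cmult_indicator)
    also have "\<dots> \<le> (\<integral>\<^sup>+x. p x \<partial>M)" by (rule int)
    also have "\<dots> = (\<integral>\<^sup>+x. g x \<partial>M) + k * emeasure M (B n)"
      unfolding pg by (subst nn_integral_add) (auto simp: nn_integral_cmult_indicator)
    also have "\<dots> \<le> (\<integral>\<^sup>+x. g x \<partial>N) + k * emeasure M (B n)"
      by (intro add_right_mono nn_integral_mono_measure sets le)
    finally have "k * emeasure N (B n) \<le> k * emeasure M (B n)"
    proof (rule ennreal_add_left_cancel_le[THEN iffD1, THEN disjE])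
      assume "(\<integral>\<^sup>+x. g x \<partial>N) = \<infinity>"
      moreover have "(\<integral>\<^sup>+x. g x \<partial>N) \<le> (\<integral>\<^sup>+x. p x \<partial>N)" by (intro nn_integral_mono) (simp add: g_def diff_le_self_ennreal)
      ultimately show ?thesis using fin by (simp add: top_unique)
    qed
    then show ?thesis using k by (simp add: ennreal_mult_le_mult_iff)
  qed
  note le_B = this
  have UB: "(\<Union>n. B n) = space N"
  proof safe
    fix x assume x: "x \<in> space N"
    obtain n :: nat where "ennreal (1 / Suc n) \<le> p x"
    proof (cases "p x")
      case (real r)
      then have "0 < r" using pos[OF x] by simp
      then obtain n where "1 / Suc n < r" by (rule nat_approx_posE)
      then show thesis using real by (intro that[of n]) (auto intro: ennreal_leI)
    next
      case top
      then show thesis by (intro that[of 0]) simp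
    qed
    then show "x \<in> (\<Union>n. B n)" using x by (auto simp: B_def)
  qed (auto simp: B_def)
  have inc: "incseq B"
    unfolding incseq_def B_def
    by (auto intro: order_trans[rotated] ennreal_leI simp: frac_le)
  have "emeasure N (space N) = (SUP n. emeasure N (B n))"
    using SUP_emeasure_incseq[OF _ inc, of N] B by (simp add: UB image_subset_iff)
  also have "\<dots> \<le> (SUP n. emeasure M (B n))"
    by (intro SUP_mono) (use le_B in auto)
  also have "\<dots> = emeasure M (space N)"
    using SUP_emeasure_incseq[OF _ inc, of M] BM by (simp add: UB image_subset_iff)
  finally show ?thesis .
qed

lemma nn_integral_split_set:
  assumes "Y \<in> sets M" "g \<in> borel_measurable M"
  shows "(\<integral>\<^sup>+x. g x \<partial>M) = (\<integral>\<^sup>+x. g x * indicator Y x \<partial>M) + (\<integral>\<^sup>+x. g x * indicator (space M - Y) x \<partial>M)"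
  using assms
  by (subst nn_integral_add[symmetric]) (auto intro!: nn_integral_cong split: split_indicator)

text \<open>
  Here \<open>p x\<close> is the probability to go from \<open>x\<close> to \<open>Y\<close>: under an invariant measure the flux out of \<open>Y\<close>
  equals the flux into \<open>Y\<close>.
\<close>

lemma stationary_flux_balance:
  fixes p :: "'a \<Rightarrow> ennreal"
  assumes M: "prob_space M" and Y: "Y \<in> sets M" and p: "p \<in> borel_measurable M" "\<And>x. p x \<le> 1"
    and inv: "(\<integral>\<^sup>+x. p x \<partial>M) = emeasure M Y"
  shows "(\<integral>\<^sup>+x. (1 - p x) * indicator Y x \<partial>M) = (\<integral>\<^sup>+x. p x * indicator (space M - Y) x \<partial>M)"
proof -
  interpret prob_space M by fact
  let ?a = "\<integral>\<^sup>+x. p x * indicator Y x \<partial>M"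
  have "p x + (1 - p x) = 1" for x
    using diff_add_cancel_ennreal[OF p(2)] by (simp add: add.commute)
  then have "p x * indicator Y x + (1 - p x) * indicator Y x = indicator Y x" for x
    by (simp only: distrib_right[symmetric] mult_1_left)
  then have "?a + (\<integral>\<^sup>+x. (1 - p x) * indicator Y x \<partial>M) = (\<integral>\<^sup>+x. indicator Y x \<partial>M)"
    using p(1) Y by (subst nn_integral_add[symmetric]) (simp_all del: nn_integral_indicator)
  also have "\<dots> = (\<integral>\<^sup>+x. p x \<partial>M)"
    using Y inv by simp
  also have "\<dots> = ?a + (\<integral>\<^sup>+x. p x * indicator (space M - Y) x \<partial>M)"
    by (rule nn_integral_split_set[OF Y p(1)])
  finally have eq: "?a + (\<integral>\<^sup>+x. (1 - p x) * indicator Y x \<partial>M) = ?a + (\<integral>\<^sup>+x. p x * indicator (space M - Y) x \<partial>M)" .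
  have "?a \<le> (\<integral>\<^sup>+x. 1 \<partial>M)"
    using p(2) by (intro nn_integral_mono) (auto split: split_indicator)
  then have "?a \<noteq> \<infinity>" by (auto simp: emeasure_space_1 top_unique)
  with eq show ?thesis by (simp add: ennreal_add_left_cancel)
qed

text \<open>
  The flux out of \<open>Y\<close> is at least as large for \<open>\<mu>\<close> as for \<open>\<nu>\<close>, the flux into \<open>Y\<close> is at most as
  large, and for either measure the two are equal; so all four agree. Since the flux into \<open>Y\<close> integrates a positive function over the
  complement of \<open>Y\<close>, the two measures have the same mass there, hence also on \<open>Y\<close>. Ordered measures
  with equal total mass coincide, on \<open>Y\<close> and on the complement.
\<close>

lemma stationary_measures_eq:
  fixes p :: "'a \<Rightarrow> ennreal"
  assumes \<mu>: "prob_space \<mu>" and \<nu>: "prob_space \<nu>" and sets: "sets \<nu> = sets \<mu>" and Y: "Y \<in> sets \<mu>"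
    and above: "\<And>X. X \<in> sets \<mu> \<Longrightarrow> X \<subseteq> Y \<Longrightarrow> emeasure \<nu> X \<le> emeasure \<mu> X"
    and below: "\<And>X. X \<in> sets \<mu> \<Longrightarrow> X \<inter> Y = {} \<Longrightarrow> emeasure \<mu> X \<le> emeasure \<nu> X"
    and p: "p \<in> borel_measurable \<mu>" "\<And>x. p x \<le> 1" and pos: "\<And>x. x \<in> space \<mu> \<Longrightarrow> 0 < p x"
    and inv: "(\<integral>\<^sup>+x. p x \<partial>\<mu>) = emeasure \<mu> Y" "(\<integral>\<^sup>+x. p x \<partial>\<nu>) = emeasure \<nu> Y"
  shows "\<mu> = \<nu>"
proof -
  interpret \<mu>: prob_space \<mu> by fact
  interpret \<nu>: prob_space \<nu> by fact
  have space: "space \<nu> = space \<mu>" by (rule sets_eq_imp_space_eq[OF sets])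
  have p\<nu>: "p \<in> borel_measurable \<nu>" using p(1) by (simp add: measurable_cong_sets[OF sets refl])
  have Y\<nu>: "Y \<in> sets \<nu>" using Y sets by simp
  let ?C = "space \<mu> - Y"
  have C: "?C \<in> sets \<mu>" "?C \<in> sets \<nu>" using Y sets by auto
  let ?r = "\<lambda>M B. density M (indicator B) :: 'a measure"
  have dens: "emeasure (?r M B) X = emeasure M (B \<inter> X)" if "X \<in> sets M" "B \<in> sets M" for M B X
    using that by (intro emeasure_restricted)
  have dens_int: "(\<integral>\<^sup>+x. g x \<partial>?r M B) = (\<integral>\<^sup>+x. g x * indicator B x \<partial>M)"
    if "g \<in> borel_measurable M" "B \<in> sets M" for g M B
    using that by (subst nn_integral_density) (auto simp: mult.commute)
  have le: "?r \<nu> Y \<le> ?r \<mu> Y"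
    using sets Y Y\<nu> by (subst le_measure) (auto simp: dens intro!: above)
  have le': "?r \<mu> ?C \<le> ?r \<nu> ?C"
    using sets C by (subst le_measure) (auto simp: dens intro!: below)
  have "(\<integral>\<^sup>+x. p x \<partial>?r \<nu> ?C) = (\<integral>\<^sup>+x. 1 - p x \<partial>?r \<nu> Y)"
    using stationary_flux_balance[OF \<nu> Y\<nu> p\<nu> p(2) inv(2)] p\<nu> C Y\<nu> by (simp add: dens_int space)
  also have "\<dots> \<le> (\<integral>\<^sup>+x. 1 - p x \<partial>?r \<mu> Y)"
    using sets by (intro nn_integral_mono_measure le) simp
  also have "\<dots> = (\<integral>\<^sup>+x. p x \<partial>?r \<mu> ?C)"
    using stationary_flux_balance[OF \<mu> Y p(1) p(2) inv(1)] p(1) C Y by (simp add: dens_int)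
  finally have int: "(\<integral>\<^sup>+x. p x \<partial>?r \<nu> ?C) \<le> (\<integral>\<^sup>+x. p x \<partial>?r \<mu> ?C)" .
  have "emeasure (?r \<nu> ?C) (space (?r \<nu> ?C)) \<le> emeasure (?r \<mu> ?C) (space (?r \<nu> ?C))"
  proof (rule le_measure_eq_total_mass[OF _ _ le' _ _ int])
    show "finite_measure (?r \<nu> ?C)"
      using C by (intro finite_measureI) (simp add: dens)
    have "(\<integral>\<^sup>+x. p x \<partial>?r \<nu> ?C) \<le> (\<integral>\<^sup>+x. 1 \<partial>\<nu>)"
      unfolding dens_int[OF p\<nu> C(2)] using p(2) by (intro nn_integral_mono) (simp split: split_indicator)
    then show "(\<integral>\<^sup>+x. p x \<partial>?r \<nu> ?C) < \<infinity>"
      using order_le_less_trans[of _ 1 "\<infinity>::ennreal"] by (simp add: \<nu>.emeasure_space_1)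
  qed (use sets p\<nu> pos in \<open>auto simp: space\<close>)
  then have C_le: "emeasure \<nu> ?C \<le> emeasure \<mu> ?C"
    using C by (simp add: dens space) (metis C(1) C(2) Diff_subset inf.absorb1 dens sets.top space)
  have mC: "measure \<nu> ?C \<le> measure \<mu> ?C"
    using C_le by (simp add: \<mu>.emeasure_eq_measure \<nu>.emeasure_eq_measure)
  have mY: "measure \<mu> Y = 1 - measure \<mu> ?C" "measure \<nu> Y = 1 - measure \<nu> ?C"
    using \<mu>.prob_compl[OF Y] \<nu>.prob_compl[OF Y\<nu>] by (simp_all add: space)
  show ?thesis
  proof (rule measure_eqI)
    fix X assume X: "X \<in> sets \<mu>"
    then have X\<nu>: "X \<in> sets \<nu>" using sets by simp
    have a: "measure \<nu> (X \<inter> Y) \<le> measure \<mu> (X \<inter> Y)" "measure \<nu> (Y - X) \<le> measure \<mu> (Y - X)"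
      using above[of "X \<inter> Y"] above[of "Y - X"] X Y by (auto simp: \<mu>.emeasure_eq_measure \<nu>.emeasure_eq_measure)
    have b: "measure \<mu> (X - Y) \<le> measure \<nu> (X - Y)" "measure \<mu> (?C - X) \<le> measure \<nu> (?C - X)"
      using below[of "X - Y"] below[of "?C - X"] X Y by (auto simp: \<mu>.emeasure_eq_measure \<nu>.emeasure_eq_measure)
    have split: "measure M Y = measure M (X \<inter> Y) + measure M (Y - X)" "measure M X = measure M (X \<inter> Y) + measure M (X - Y)"
      "measure M ?C = measure M (X - Y) + measure M (?C - X)"
      if "prob_space M" "sets M = sets \<mu>" for M
    proof -
      interpret prob_space M by fact
      have XY: "X \<in> sets M" "Y \<in> sets M" "?C \<in> sets M" using X Y that by auto
      have sX: "X \<subseteq> space \<mu>" using X by (rule sets.sets_into_space)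
      have "Y = (X \<inter> Y) \<union> (Y - X)" "X = (X \<inter> Y) \<union> (X - Y)" "?C = (X - Y) \<union> (?C - X)"
        using sX by auto
      then show "measure M Y = measure M (X \<inter> Y) + measure M (Y - X)" "measure M X = measure M (X \<inter> Y) + measure M (X - Y)"
        "measure M ?C = measure M (X - Y) + measure M (?C - X)"
        using XY by (metis (no_types, lifting) finite_measure_Union sets.Int sets.Diff Diff_disjoint inf_commute Int_Diff Diff_Int_distrib inf_assoc Int_empty_right)+
    qed
    have "measure \<mu> X = measure \<nu> X"
      using a b mC mY split[OF \<mu> refl] split[OF \<nu> sets] by linarith
    then show "emeasure \<mu> X = emeasure \<nu> X"
      by (simp add: \<mu>.emeasure_eq_measure \<nu>.emeasure_eq_measure)
  qed (use sets in simp)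
qed

text \<open>
  The roles of the two measures and of the Hahn set and its complement can be exchanged, so it suffices
  that one of these two sets has positive equilibrium measure.
\<close>

lemma unique_invariant:
  assumes E: "0 < E" and inv: "invariant_prob E (\<mu> :: 'm::finite state measure)"
  shows "\<mu> = equilibrium E"
proof -
  let ?pi = "equilibrium E :: 'm state measure"
  have \<mu>: "prob_space \<mu>" "sets \<mu> = sets (simplex_space E)"
    using inv by (auto simp: invariant_prob_def prob_on_simplex_def)
  interpret \<mu>: prob_space \<mu> by fact
  interpret pi: prob_space ?pi using E by (rule prob_space_equilibrium)
  have sp: "space \<mu> = simplex_set E" using sets_eq_imp_space_eq[OF \<mu>(2)] by simp
  have stat: "(\<integral>\<^sup>+z. occupation A 1 z \<partial>\<mu>) = emeasure \<mu> A" "(\<integral>\<^sup>+z. occupation A 1 z \<partial>?pi) = emeasure ?pi A"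
    if "A \<in> sets (simplex_space E)" for A
    using inv that evolved_eq[OF \<mu>(2) that, of 1] equilibrium_occupation[OF E that, of 1]
    by (auto simp: invariant_prob_def)
  have meas: "occupation A 1 \<in> borel_measurable M" if "A \<in> sets (simplex_space E)" "sets M = sets (simplex_space E)"
    for A and M :: "'m state measure"
  proof -
    have A: "A \<in> sets borel" using that by (simp add: sets_simplex_space)
    have "occupation A 1 \<in> borel_measurable borel"
      using measurable_compose[of "\<lambda>z. (1, z)" borel "borel \<Otimes>\<^sub>M borel", OF _ measurable_occupation[OF A]] by simp
    from borel_measurable_simplex_space[OF this] show ?thesis
      by (simp add: measurable_cong_sets[OF that(2) refl])
  qed
  obtain Y where Y: "Y \<in> sets \<mu>"
    and above: "\<And>X. X \<in> sets \<mu> \<Longrightarrow> X \<subseteq> Y \<Longrightarrow> emeasure ?pi X \<le> emeasure \<mu> X"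
    and below: "\<And>X. X \<in> sets \<mu> \<Longrightarrow> X \<inter> Y = {} \<Longrightarrow> emeasure \<mu> X \<le> emeasure ?pi X"
    using finite_unsigned_Hahn_decomposition[OF \<mu>.finite_measure pi.finite_measure] \<mu>(2) by auto
  have Ys: "Y \<in> sets (simplex_space E)" using Y \<mu>(2) by simp
  show ?thesis
  proof (cases "emeasure ?pi Y = 0")
    case False
    show ?thesis
    proof (rule stationary_measures_eq[OF \<mu>(1) pi.prob_space_axioms _ Y above below])
      show "occupation Y 1 \<in> borel_measurable \<mu>" by (rule meas[OF Ys \<mu>(2)])
      show "0 < occupation Y 1 z" if "z \<in> space \<mu>" for z
        using irreducible[OF E Ys False] that by (simp add: sp)
    qed (use \<mu>(2) stat[OF Ys] in \<open>auto intro: occupation_le_1\<close>)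
  next
    case True
    let ?C = "space \<mu> - Y"
    have Cs: "?C \<in> sets (simplex_space E)" using Y \<mu>(2) by auto
    have "emeasure ?pi ?C = 1"
      using pi.prob_compl[of Y] True Ys by (simp add: sp pi.emeasure_eq_measure)
    then have pos: "emeasure ?pi ?C \<noteq> 0" by simp
    have "?pi = \<mu>"
    proof (rule stationary_measures_eq[OF pi.prob_space_axioms \<mu>(1)])
      show "occupation ?C 1 \<in> borel_measurable ?pi" by (rule meas[OF Cs]) simp
      show "0 < occupation ?C 1 z" if "z \<in> space ?pi" for z
        using irreducible[OF E Cs pos] that by simp
      show "emeasure \<mu> X \<le> emeasure ?pi X" if "X \<in> sets ?pi" "X \<subseteq> ?C" for X
        using that \<mu>(2) by (intro below) auto
      show "emeasure ?pi X \<le> emeasure \<mu> X" if "X \<in> sets ?pi" "X \<inter> ?C = {}" for X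
        using that \<mu>(2) sets.sets_into_space[of X \<mu>] by (intro above) auto
    qed (use \<mu>(2) Cs stat[OF Cs] in \<open>auto intro: occupation_le_1\<close>)
    then show ?thesis by simp
  qed
qed

lemma ergodic_equilibrium:
  assumes E: "0 < E"
  shows "ergodic_prob E (equilibrium E :: 'm::finite state measure)"
  unfolding ergodic_prob_def
proof (intro conjI ballI impI invariant_equilibrium E)
  let ?pi = "equilibrium E :: 'm state measure"
  interpret pi: prob_space ?pi using E by (rule prob_space_equilibrium)
  fix A :: "'m state set" assume A: "A \<in> sets (simplex_space E)"
    and inv: "\<forall>t>0. AE z in ?pi. emeasure (transition E t z) A = indicator A z"
  have "AE z in ?pi. z \<in> A" if "emeasure ?pi A \<noteq> 0"
  proof -
    have "AE z in ?pi. emeasure (transition E 1 z) A = indicator A z" using inv by simp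
    moreover have "AE z in ?pi. z \<in> simplex_set E" using AE_space[of ?pi] by simp
    ultimately show ?thesis
    proof eventually_elim
      case (elim z)
      have "0 < occupation A 1 z" using irreducible[OF E A that elim(2)] by simp
      then show ?case using elim(1) emeasure_transition[OF elim(2) A, of 1] by (auto split: split_indicator_asm)
    qed
  qed
  moreover have "A \<in> sets ?pi" using A by simp
  ultimately show "emeasure ?pi A = 0 \<or> emeasure ?pi A = 1"
    using pi.emeasure_eq_1_AE[of A] by auto
qed

theorem theorem1:
  fixes E :: real
  assumes "0 < E"
  shows "invariant_prob E (equilibrium E :: 'm::finite state measure)
    \<and> (\<forall>\<mu> :: 'm state measure. invariant_prob E \<mu> \<longrightarrow> \<mu> = equilibrium E)
    \<and> ergodic_prob E (equilibrium E :: 'm state measure)"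
  using invariant_equilibrium[OF assms] unique_invariant[OF assms] ergodic_equilibrium[OF assms] by blast

end
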